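(* Let $r\ge 1$, $m_0\ge m_1\ge\cdots\ge m_r\ge 1$, $A_0$ a real symmetric positive definite $m_0\times m_0$ matrix, and $B_k$ a real $m_{k-1}\times m_k$ matrix of rank $m_k$ for $k=1,\dots,r$. Let $A$, $B$ be the associated $N\times N$ block matrices defined in the context, $\mathcal{L}=\frac12\mathrm{div}(AD)+\langle x,BD\rangle$ on $\mathbb{R}^N=\mathbb{R}^{m_0}\times\cdots\times\mathbb{R}^{m_r}$, and $\mathcal{C}(t)=\int_0^tE(s)AE^*(s)\,ds$ with $E(t)=\exp(-tB^* )$. Let $u$ be the positive bounded solution to the heat equation $\mathcal{L}u(x,t)=\partial_tu(x,t)$ on $\mathbb{R}^N\times(0,\infty)$ with initial value $f$ (at $t=0$) satisfying $0\le f\le C$, where $C$ is a constant. Then for every $x\in\mathbb{R}^N$ and $t>0$, $$\frac12\left\langle\mathcal{C}(t)\nabla\ln u(x,t),\nabla\ln u(x,t)\right\rangle\le\ln\frac{C}{u(x,t)}.$$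
   Context: $N=\sum_{k=0}^rm_k$. In block form (block sizes $m_0,\dots,m_r$), $A=\begin{pmatrix}A_0&0\\0&0\end{pmatrix}$ is the $N\times N$ matrix with upper left block $A_0$ and zeros elsewhere, and $B$ is the $N\times N$ matrix whose $(k,k+1)$ block is $B_k$ for $1\le k\le r$ and all of whose other blocks are zero. $M^*$ denotes the transpose of a matrix $M$; $E^*(t)$ is the transpose of $E(t)$. Under these assumptions $\mathcal{C}(t)$ is positive definite for every $t>0$. $D=(\partial_{x_1},\dots,\partial_{x_N})$; $\nabla$ is the full gradient in the space variable $x\in\mathbb{R}^N$; $\langle\cdot,\cdot\rangle$ is the Euclidean inner product; $\mathcal{L}$ acts in the variable $x$. *)

theory Defs
  imports "HOL-Analysis.Analysis" "Jordan_Normal_Form.DL_Rank"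
begin

(* Matrices whose sizes m k are numbers quantified inside the statement have the type mat of
   Jordan_Normal_Form; analysis in the space variable takes place in real ^ 'n.  The two libraries
   share the symbols below, which are kept for HOL-Analysis. *)

no_notation Matrix.vec_index (infixl "$" 100)
no_notation Matrix.scalar_prod (infix "\<bullet>" 70)

definition pos_def_mat :: "nat \<Rightarrow> real mat \<Rightarrow> bool" where
  "pos_def_mat n M \<longleftrightarrow>
     (\<forall>v \<in> carrier_vec n. v \<noteq> 0\<^sub>v n \<longrightarrow> 0 < Matrix.scalar_prod v (M *\<^sub>v v))"

(* R^N = R^(m 0) x ... x R^(m r): c p = (k, i) says that the p-th coordinate of R^N is the i-th
   coordinate of the k-th factor (blocks numbered 0..r, coordinates inside a block from 0).  Being
   a bijection onto the set of all such pairs, c forces CARD('n) = m 0 + ... + m r. *)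

definition block_coordinates :: "nat \<Rightarrow> (nat \<Rightarrow> nat) \<Rightarrow> ('n \<Rightarrow> nat \<times> nat) \<Rightarrow> bool" where
  "block_coordinates r m c \<longleftrightarrow> bij_betw c UNIV (SIGMA k:{..r}. {..<m k})"

definition block_A :: "('n \<Rightarrow> nat \<times> nat) \<Rightarrow> real mat \<Rightarrow> real ^ 'n ^ 'n" where
  "block_A c A0 = (\<chi> p q.
     if fst (c p) = 0 \<and> fst (c q) = 0 then A0 $$ (snd (c p), snd (c q)) else 0)"

(* With blocks numbered from 0, the m (k-1) x m k matrix Bs k occupies block row k - 1 and block
   column k. *)

definition block_B :: "('n \<Rightarrow> nat \<times> nat) \<Rightarrow> (nat \<Rightarrow> real mat) \<Rightarrow> real ^ 'n ^ 'n" where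
  "block_B c Bs = (\<chi> p q.
     if fst (c q) = fst (c p) + 1 then Bs (fst (c q)) $$ (snd (c p), snd (c q)) else 0)"

(* The Banach algebra exponential exp is not available here: multiplication on real ^ 'n ^ 'n as
   a type class operation is componentwise, not the matrix product. *)

definition matrix_exp :: "real ^ 'n ^ 'n \<Rightarrow> real ^ 'n ^ 'n" where
  "matrix_exp M = (\<Sum>k. (1 / fact k) *\<^sub>R (((**) M ^^ k) (Finite_Cartesian_Product.mat 1)))"

definition flow_E :: "real ^ 'n ^ 'n \<Rightarrow> real \<Rightarrow> real ^ 'n ^ 'n" where
  "flow_E B t = matrix_exp ((- t) *\<^sub>R transpose B)"

definition covariance :: "real ^ 'n ^ 'n \<Rightarrow> real ^ 'n ^ 'n \<Rightarrow> real \<Rightarrow> real ^ 'n ^ 'n" where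
  "covariance A B t = integral {0..t} (\<lambda>s. flow_E B s ** A ** transpose (flow_E B s))"

definition grad :: "(real ^ 'n \<Rightarrow> real) \<Rightarrow> real ^ 'n \<Rightarrow> real ^ 'n" where
  "grad g x = (\<chi> i. frechet_derivative g (at x) (axis i 1))"

definition divergence :: "(real ^ 'n \<Rightarrow> real ^ 'n) \<Rightarrow> real ^ 'n \<Rightarrow> real" where
  "divergence F x = (\<Sum>i\<in>UNIV. frechet_derivative F (at x) (axis i 1) $ i)"

definition kolmogorov_op ::
  "real ^ 'n ^ 'n \<Rightarrow> real ^ 'n ^ 'n \<Rightarrow> (real ^ 'n \<Rightarrow> real) \<Rightarrow> real ^ 'n \<Rightarrow> real" where
  "kolmogorov_op A B g x = 1 / 2 * divergence (\<lambda>y. A *v grad g y) x + x \<bullet> (B *v grad g x)"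

(* Class C^{2,1} on R^N x (0, oo): the first and second space derivatives and the first time
   derivative exist and, like u, are jointly continuous. *)

definition C21 :: "(real ^ 'n \<Rightarrow> real \<Rightarrow> real) \<Rightarrow> bool" where
  "C21 u \<longleftrightarrow>
     (\<forall>x. \<forall>t>0. (\<lambda>y. u y t) differentiable (at x) \<and>
               grad (\<lambda>y. u y t) differentiable (at x) \<and>
               u x differentiable (at t)) \<and>
     continuous_on (UNIV \<times> {0<..}) (\<lambda>(x, t). u x t) \<and>
     continuous_on (UNIV \<times> {0<..}) (\<lambda>(x, t). grad (\<lambda>y. u y t) x) \<and>
     continuous_on (UNIV \<times> {0<..}) (\<lambda>(x, t). jacobian (grad (\<lambda>y. u y t)) (at x)) \<and>
     continuous_on (UNIV \<times> {0<..}) (\<lambda>(x, t). deriv (u x) t)"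

(* f is only a bounded function, so the initial value is attained in the sense of distributions
   as t decreases to 0.  For bounded u this is implied by convergence locally uniformly,
   pointwise almost everywhere, or in L^1_loc. *)

definition has_initial_value :: "(real ^ 'n \<Rightarrow> real \<Rightarrow> real) \<Rightarrow> (real ^ 'n \<Rightarrow> real) \<Rightarrow> bool" where
  "has_initial_value u f \<longleftrightarrow>
     (\<forall>\<phi> :: real ^ 'n \<Rightarrow> real.
        continuous_on UNIV \<phi> \<and> compact (closure {x. \<phi> x \<noteq> 0}) \<longrightarrow>
        ((\<lambda>t. LINT x|lebesgue. u x t * \<phi> x) \<longlongrightarrow> (LINT x|lebesgue. f x * \<phi> x)) (at_right 0))"

definition pos_bounded_solution ::
  "real ^ 'n ^ 'n \<Rightarrow> real ^ 'n ^ 'n \<Rightarrow> (real ^ 'n \<Rightarrow> real) \<Rightarrow> (real ^ 'n \<Rightarrow> real \<Rightarrow> real) \<Rightarrow> bool" where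
  "pos_bounded_solution A B f u \<longleftrightarrow>
     C21 u \<and>
     (\<forall>x. \<forall>t>0. kolmogorov_op A B (\<lambda>y. u y t) x = deriv (u x) t) \<and>
     (\<forall>x. \<forall>t>0. 0 < u x t) \<and>
     (\<exists>K. \<forall>x. \<forall>t>0. u x t \<le> K) \<and>
     has_initial_value u f"

end

theory Submission
  imports Defs
begin

text \<open>
  Fix the time \<open>T\<close> of the estimate.  In the moving coordinates \<open>x = E(t - T) z\<close> the drift disappears: the function
  \<open>U(z, t) = u(E(t - T) z, t)\<close> solves \<open>\<partial>\<^sub>t U = 1/2 tr (a(t) D\<^sup>2 U)\<close> with \<open>a(t) = E(T - t) A E(T - t)\<^sup>T\<close>
  (\<open>smooth_heat_solution_transport\<close>).  At time \<open>T\<close> the gradient is that of \<open>u\<close>, and \<open>\<Gamma>(t)\<close>, the integral of \<open>a\<close> over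
  \<open>[0, t]\<close>, takes the value \<open>C(T)\<close>, the covariance.  It remains to prove the estimate for \<open>U\<close> with \<open>\<Gamma>(T)\<close> in place of the
  covariance.

  The heat equation without drift is invariant under Gaussian shifts: together with \<open>U(x, t)\<close> also
  \<open>exp (\<langle>\<theta>, x\<rangle> + \<kappa> + 1/2 \<langle>\<Gamma>(t) \<theta>, \<theta>\<rangle>) U(x + \<Gamma>(t) \<theta>, t)\<close> is a solution (\<open>heat_solution_exp_shift\<close>).  Suppose that
  \<open>0 < U \<le> C\<close> and write \<open>b = \<langle>\<theta>, x\<rangle> + \<kappa>\<close>.  Then \<open>b + 1 \<le> exp b\<close> gives \<open>(b + 1) U \<le> C exp b\<close> at an initial time, and
  with \<open>\<Gamma>\<close> counted from that time, the solutions that start from the two sides are later \<open>(b + 1) U + \<langle>\<Gamma> \<theta>, D U\<rangle>\<close> and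
  \<open>C exp (b + 1/2 \<langle>\<Gamma> \<theta>, \<theta>\<rangle>)\<close>.  A minimum principle (\<open>heat_minimum_principle\<close>) keeps the inequality between them.
  The choice \<open>\<theta> = D ln U\<close>, \<open>b = ln (U / C) - 1/2 \<langle>\<Gamma> \<theta>, \<theta>\<rangle>\<close> at the point of interest turns it into
  \<open>1/2 \<langle>\<Gamma> \<theta>, \<theta>\<rangle> \<le> ln (C / U)\<close>.  As \<open>U\<close> has only two derivatives in space, the factor \<open>b\<close> is replaced by
  \<open>(exp (\<epsilon> b) - 1) / \<epsilon>\<close>, for which only shifts of \<open>U\<close> are needed, and \<open>\<epsilon>\<close> tends to \<open>0\<close> at the end
  (\<open>heat_difference_quotient_bound\<close>, \<open>heat_gradient_estimate\<close>).

  The bound \<open>u \<le> C\<close> follows from \<open>f \<le> C\<close> (\<open>solution_le_initial_bound\<close>).  The initial value is attained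
  only in the sense of distributions, so the minimum principle is applied to averages of \<open>C - U\<close> over small
  translates.  These are solutions again, and their lower limits at time \<open>0\<close> are nonnegative at every point,
  after a linear change of variables that moves the flow from \<open>u\<close> to the weight.
\<close>

section \<open>The matrix exponential\<close>

lemma bounded_bilinear_matrix_mult:
  "bounded_bilinear ((**) :: real ^ 'n ^ 'm \<Rightarrow> real ^ 'p ^ 'n \<Rightarrow> real ^ 'p ^ 'm)"
  unfolding bilinear_conv_bounded_bilinear[symmetric] bilinear_def
  by (auto intro!: linearI simp: matrix_matrix_mult_def Finite_Cartesian_Product.vec_eq_iff algebra_simps sum.distrib sum_distrib_left)

lemma bounded_bilinear_matrix_vector_mult:
  "bounded_bilinear ((*v) :: real ^ 'n ^ 'm \<Rightarrow> real ^ 'n \<Rightarrow> real ^ 'm)"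
  unfolding bilinear_conv_bounded_bilinear[symmetric] bilinear_def
  by (auto intro!: linearI simp: matrix_vector_right_distrib matrix_vector_mult_add_rdistrib
      matrix_vector_mult_scaleR scaleR_matrix_vector_assoc)

lemma bounded_linear_transpose: "bounded_linear (transpose :: real ^ 'n ^ 'm \<Rightarrow> real ^ 'm ^ 'n)"
  unfolding linear_conv_bounded_linear[symmetric]
  by (auto intro!: linearI simp: transpose_def) (simp_all add: Finite_Cartesian_Product.vec_eq_iff)

lemmas continuous_on_matrix_mult [continuous_intros] = bounded_bilinear.continuous_on[OF bounded_bilinear_matrix_mult]
lemmas continuous_on_matrix_vector_mult [continuous_intros] =
  bounded_bilinear.continuous_on[OF bounded_bilinear_matrix_vector_mult]
lemmas continuous_on_transpose [continuous_intros] = bounded_linear.continuous_on[OF bounded_linear_transpose]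

abbreviation mpow :: "real ^ 'n ^ 'n \<Rightarrow> nat \<Rightarrow> real ^ 'n ^ 'n" where
  "mpow M k \<equiv> ((**) M ^^ k) (Finite_Cartesian_Product.mat 1)"

lemma mpow_commute: "mpow M k ** M = M ** mpow M k"
  by (induction k) (simp_all add: matrix_mul_assoc[symmetric])

lemma mpow_scaleR: "mpow (t *\<^sub>R M) k = t ^ k *\<^sub>R mpow M k"
  by (induction k) (simp_all add: bounded_bilinear.scaleR_left[OF bounded_bilinear_matrix_mult]
      bounded_bilinear.scaleR_right[OF bounded_bilinear_matrix_mult] power_commutes)

text \<open>
  Multiplication by \<open>M\<close> is bounded, so the powers grow at most geometrically and the factorials win.
\<close>

lemma summable_mpow:
  fixes M :: "real ^ 'n ^ 'n"
  shows "summable (\<lambda>k. (1 / fact k) *\<^sub>R mpow M k)"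
proof -
  obtain K where K: "K > 0" "\<And>X :: real ^ 'n ^ 'n. norm (M ** X) \<le> norm X * K"
    using bounded_linear.pos_bounded[OF bounded_bilinear.bounded_linear_right[OF bounded_bilinear_matrix_mult]]
    by blast
  have le: "norm (mpow M k) \<le> norm (Finite_Cartesian_Product.mat 1 :: real ^ 'n ^ 'n) * K ^ k" for k
  proof (induction k)
    case (Suc k)
    have "norm (mpow M (Suc k)) \<le> norm (mpow M k) * K" using K(2) by simp
    also have "\<dots> \<le> (norm (Finite_Cartesian_Product.mat 1 :: real ^ 'n ^ 'n) * K ^ k) * K"
      using Suc K(1) by (intro mult_right_mono) auto
    finally show ?case by (simp add: mult_ac)
  qed simp
  show ?thesis
  proof (rule summable_comparison_test')
    show "summable (\<lambda>k. norm (Finite_Cartesian_Product.mat 1 :: real ^ 'n ^ 'n) * (inverse (fact k) * K ^ k))"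
      by (intro summable_mult summable_exp)
    show "norm ((1 / fact k) *\<^sub>R mpow M k)
        \<le> norm (Finite_Cartesian_Product.mat 1 :: real ^ 'n ^ 'n) * (inverse (fact k) * K ^ k)" for k
      using le[of k] by (simp add: field_simps)
  qed
qed

lemma matrix_exp_commute: "matrix_exp M ** M = M ** matrix_exp M"
proof -
  note l = bounded_bilinear.bounded_linear_left[OF bounded_bilinear_matrix_mult]
    and r = bounded_bilinear.bounded_linear_right[OF bounded_bilinear_matrix_mult]
  show ?thesis unfolding matrix_exp_def
    by (subst bounded_linear.suminf[OF l summable_mpow], subst bounded_linear.suminf[OF r summable_mpow])
      (simp add: bounded_bilinear.scaleR_left[OF bounded_bilinear_matrix_mult]
      bounded_bilinear.scaleR_right[OF bounded_bilinear_matrix_mult] mpow_commute)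
qed

lemma matrix_exp_0: "matrix_exp (0 :: real ^ 'n ^ 'n) = Finite_Cartesian_Product.mat 1"
proof -
  have "mpow (0 *\<^sub>R (0 :: real ^ 'n ^ 'n)) k = (if k = 0 then Finite_Cartesian_Product.mat 1 else 0)" for k
    unfolding mpow_scaleR by simp
  then have "matrix_exp (0 :: real ^ 'n ^ 'n) = (\<Sum>k. if k = 0 then Finite_Cartesian_Product.mat 1 else 0)"
    unfolding matrix_exp_def by (intro suminf_cong) simp
  also have "\<dots> = (\<Sum>k\<in>{0::nat}. if k = 0 then Finite_Cartesian_Product.mat 1 else 0)"
    by (rule suminf_finite) auto
  finally show ?thesis by simp
qed

lemma has_vector_derivative_componentwise_vec:
  fixes f :: "real \<Rightarrow> 'a::euclidean_space ^ 'n"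
  assumes "\<And>i. ((\<lambda>t. f t $ i) has_vector_derivative D $ i) F"
  shows "(f has_vector_derivative D) F"
proof -
  have ax: "bounded_linear (\<lambda>y::'a. axis i y :: 'a ^ 'n)" for i
    unfolding linear_conv_bounded_linear[symmetric]
    by (auto intro!: linearI simp: axis_def Finite_Cartesian_Product.vec_eq_iff)
  have sum: "(\<Sum>i\<in>UNIV. axis i (g $ i)) = g" for g :: "'a ^ 'n"
    by (simp add: Finite_Cartesian_Product.vec_eq_iff axis_def if_distrib[of "\<lambda>x. x $ _"] sum.If_cases)
  have "((\<lambda>t. \<Sum>i\<in>UNIV. axis i (f t $ i)) has_vector_derivative (\<Sum>i\<in>UNIV. axis i (D $ i))) F"
    by (intro has_vector_derivative_sum bounded_linear.has_vector_derivative[OF ax] assms)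
  then show ?thesis by (simp add: sum)
qed

text \<open>
  Each entry of \<open>matrix_exp (t *\<^sub>R N)\<close> is a real power series in \<open>t\<close>, which may be differentiated
  term by term; the shifted coefficients are those of \<open>N ** matrix_exp (t *\<^sub>R N)\<close>.
\<close>

lemma matrix_exp_has_derivative:
  fixes N :: "real ^ 'n ^ 'n"
  shows "((\<lambda>t. matrix_exp (t *\<^sub>R N)) has_vector_derivative N ** matrix_exp (t *\<^sub>R N)) (at t)"
proof (intro has_vector_derivative_componentwise_vec)
  fix i j
  define a where "a k = mpow N k $ i $ j / fact k" for k
  have nth: "bounded_linear (\<lambda>X :: real ^ 'n ^ 'n. X $ i $ j)"
    unfolding linear_conv_bounded_linear[symmetric] by (auto intro!: linearI)
  have entry: "(\<lambda>k. a k * t ^ k) sums (matrix_exp (t *\<^sub>R N) $ i $ j)" for t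
    using bounded_linear.sums[OF nth summable_sums[OF summable_mpow[of "t *\<^sub>R N"]]]
    by (simp add: matrix_exp_def mpow_scaleR a_def mult_ac)
  have nth': "bounded_linear (\<lambda>X :: real ^ 'n ^ 'n. (N ** X) $ i $ j)"
    by (rule bounded_linear_compose[OF nth bounded_bilinear.bounded_linear_right[OF bounded_bilinear_matrix_mult]])
  have "(\<lambda>k. diffs a k * t ^ k) sums ((N ** matrix_exp (t *\<^sub>R N)) $ i $ j)"
    using bounded_linear.sums[OF nth' summable_sums[OF summable_mpow[of "t *\<^sub>R N"]]]
    by (simp add: matrix_exp_def mpow_scaleR a_def diffs_def mult_ac
        bounded_bilinear.scaleR_right[OF bounded_bilinear_matrix_mult])
  moreover have "((\<lambda>x. \<Sum>n. a n * x^n) has_field_derivative (\<Sum>n. diffs a n * t^n)) (at t)"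
    by (rule termdiffs_strong_converges_everywhere) (use entry sums_summable in blast)
  ultimately show "((\<lambda>t. matrix_exp (t *\<^sub>R N) $ i $ j) has_vector_derivative
      (N ** matrix_exp (t *\<^sub>R N)) $ i $ j) (at t)"
    using entry by (simp add: sums_iff has_real_derivative_iff_has_vector_derivative)
qed

lemma flow_E_has_derivative:
  "((\<lambda>t. flow_E B t) has_vector_derivative - (transpose B ** flow_E B t)) (at t)"
proof -
  have eq: "flow_E B t = matrix_exp (t *\<^sub>R (- transpose B))" for t
    by (simp add: flow_E_def)
  show ?thesis unfolding eq
    using matrix_exp_has_derivative[of "- transpose B" t]
    by (simp add: bounded_bilinear.minus_left[OF bounded_bilinear_matrix_mult])
qed

lemma flow_E_commute: "flow_E B t ** transpose B = transpose B ** flow_E B t"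
proof (cases "t = 0")
  case False
  have "flow_E B t ** ((- t) *\<^sub>R transpose B) = ((- t) *\<^sub>R transpose B) ** flow_E B t"
    using matrix_exp_commute by (simp only: flow_E_def)
  then show ?thesis using False
    by (simp add: bounded_bilinear.scaleR_left[OF bounded_bilinear_matrix_mult] bounded_bilinear.minus_left[OF bounded_bilinear_matrix_mult]
      bounded_bilinear.minus_right[OF bounded_bilinear_matrix_mult] bounded_bilinear.scaleR_right[OF bounded_bilinear_matrix_mult])
qed (simp add: flow_E_def matrix_exp_0)

lemma flow_E_0 [simp]: "flow_E B 0 = Finite_Cartesian_Product.mat 1"
  by (simp add: flow_E_def matrix_exp_0)

text \<open>
  The product has derivative zero because \<open>transpose B\<close> commutes with the flow, and it is the identity at
  time \<open>0\<close>.
\<close>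

lemma flow_E_inverse: "flow_E B t ** flow_E B (- t) = Finite_Cartesian_Product.mat 1"
proof -
  have 1: "((\<lambda>t. flow_E B (- t)) has_vector_derivative transpose B ** flow_E B (- t)) (at t)" for t
    using vector_diff_chain_at[OF _ flow_E_has_derivative, of uminus "-1" t B]
    by (simp add: o_def has_vector_derivative_minus has_vector_derivative_id
        bounded_bilinear.minus_left[OF bounded_bilinear_matrix_mult] derivative_eq_intros)
  have "((\<lambda>t. flow_E B t ** flow_E B (- t)) has_vector_derivative
      flow_E B t ** (transpose B ** flow_E B (- t)) + - (transpose B ** flow_E B t) ** flow_E B (- t)) (at t)" for t
    by (rule bounded_bilinear.has_vector_derivative[OF bounded_bilinear_matrix_mult flow_E_has_derivative 1])
  then have "((\<lambda>t. flow_E B t ** flow_E B (- t)) has_vector_derivative 0) (at t)" for t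
    by (simp add: matrix_mul_assoc flow_E_commute bounded_bilinear.minus_left[OF bounded_bilinear_matrix_mult])
  then obtain c where "\<And>t. flow_E B t ** flow_E B (- t) = c"
    using has_derivative_zero_constant[of UNIV "\<lambda>t. flow_E B t ** flow_E B (- t)"]
    by (auto simp: has_vector_derivative_def)
  from this[of t] this[of 0] show ?thesis by simp
qed

lemma continuous_on_flow_E [continuous_intros]:
  "continuous_on S g \<Longrightarrow> continuous_on S (\<lambda>x. flow_E B (g x))"
proof -
  have "continuous_on UNIV (flow_E B)"
    by (meson continuous_at_imp_continuous_on flow_E_has_derivative has_vector_derivative_continuous)
  then show "continuous_on S g \<Longrightarrow> continuous_on S (\<lambda>x. flow_E B (g x))"
    by (rule continuous_on_compose2) auto
qed

section \<open>Second-order conditions at a minimum\<close>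

text \<open>
  The trace of \<open>a\<close> times a Hessian, with the Hessian given as a linear map.  Derivatives appear as
  linear maps, and in this form rank-one Hessians need no matrix notation.
\<close>

definition hess_trace :: "real ^ 'n ^ 'n \<Rightarrow> (real ^ 'n \<Rightarrow> real ^ 'n) \<Rightarrow> real" where
  "hess_trace a H = (\<Sum>i\<in>UNIV. (a *v H (axis i 1)) $ i)"

lemma hess_trace_add: "hess_trace a (\<lambda>h. H h + K h) = hess_trace a H + hess_trace a K"
  by (simp add: hess_trace_def matrix_vector_right_distrib sum.distrib)

lemma hess_trace_scaleR: "hess_trace a (\<lambda>h. c *\<^sub>R H h) = c * hess_trace a H"
  by (simp add: hess_trace_def matrix_vector_mult_scaleR sum_distrib_left)

lemma hess_trace_matrix: "hess_trace a ((*v) M) = trace (a ** M)"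
  by (simp add: hess_trace_def trace_def matrix_vector_mult_basis column_def)
    (simp add: matrix_vector_mult_def matrix_matrix_mult_def)

lemma hess_trace_rank_one: "hess_trace a (\<lambda>h. (\<theta> \<bullet> h) *\<^sub>R v) = \<theta> \<bullet> (a *v v)"
  by (simp add: hess_trace_def matrix_vector_mult_scaleR inner_axis) (simp add: inner_vec_def)

text \<open>
  Otherwise, for some \<open>q\<close>, the value of the form at \<open>s *\<^sub>R axis p 1 + axis q 1\<close> would be an affine,
  nonconstant function of \<open>s\<close>, hence negative for some \<open>s\<close>.
\<close>

lemma psd_zero_row:
  fixes a :: "real ^ 'n ^ 'n"
  assumes sym: "transpose a = a" and psd: "\<And>v. 0 \<le> (a *v v) \<bullet> v" and "a $ p $ p = 0"
  shows "a $ p = 0"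
proof -
  have "a $ p $ q = 0" for q
  proof -
    have qp: "a $ q $ p = a $ p $ q"
      using arg_cong[OF sym, of "\<lambda>b. b $ p $ q"] by (simp add: transpose_def)
    define b where "b = a $ q $ q"
    define c where "c = a $ p $ q"
    have "0 \<le> 2 * s * c + b" for s
    proof -
      have "(a *v (s *\<^sub>R axis p 1 + axis q 1)) \<bullet> (s *\<^sub>R axis p 1 + axis q 1) = 2 * s * c + b"
        by (simp add: matrix_vector_right_distrib matrix_vector_mult_scaleR inner_add_left inner_add_right
            inner_axis matrix_vector_mult_basis column_def assms(3) qp b_def c_def)
      then show ?thesis using psd by metis
    qed
    from this[of "- (b + 1) / (2 * c)"] have "c = 0"
      by (cases "c = 0") (auto simp: field_simps)
    then show ?thesis by (simp add: c_def)
  qed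
  then show ?thesis by (simp add: Finite_Cartesian_Product.vec_eq_iff)
qed

text \<open>
  The trace of the product of two positive semidefinite forms is nonnegative.  One step of Cholesky
  elimination splits off a rank-one form \<open>R\<close> from \<open>a\<close>, on which the trace is a value of the quadratic
  form of \<open>H\<close>; the remainder is again positive semidefinite and has more zero rows.
\<close>

lemma hess_trace_nonneg:
  fixes a :: "real ^ 'n ^ 'n"
  assumes "transpose a = a" and "\<And>v. 0 \<le> (a *v v) \<bullet> v"
    and lin: "linear H" and H: "\<And>v. 0 \<le> H v \<bullet> v"
  shows "0 \<le> hess_trace a H"
  using assms(1,2)
proof (induction "card {i. a $ i \<noteq> 0}" arbitrary: a rule: less_induct)
  case less
  note sym = less.prems(1) and psd = less.prems(2)
  show ?case
  proof (cases "\<forall>i. a $ i = 0")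
    case True
    then have "a = 0" by (simp add: Finite_Cartesian_Product.vec_eq_iff)
    then show ?thesis by (simp add: hess_trace_def)
  next
    case False
    then obtain p where p: "a $ p \<noteq> 0" by blast
    have ij: "a $ i $ j = a $ j $ i" for i j
      using arg_cong[OF sym, of "\<lambda>b. b $ j $ i"] by (simp add: transpose_def)
    have "0 \<le> a $ p $ p" using psd[of "axis p 1"]
      by (simp add: inner_axis matrix_vector_mult_basis column_def)
    moreover have "a $ p $ p \<noteq> 0" using psd_zero_row[OF sym psd] p by blast
    ultimately have pp: "0 < a $ p $ p" by simp
    define d where "d = a $ p $ p"
    define c where "c = a $ p"
    define R :: "real ^ 'n ^ 'n" where "R = (\<chi> i j. c $ i * c $ j / d)"
    have Rv: "R *v v = ((c \<bullet> v) / d) *\<^sub>R c" for v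
      by (simp add: R_def matrix_vector_mult_def Finite_Cartesian_Product.vec_eq_iff inner_vec_def
          sum_distrib_left sum_distrib_right sum_divide_distrib mult_ac)
    have ac: "a *v axis p 1 = c"
      by (simp add: matrix_vector_mult_basis column_def c_def Finite_Cartesian_Product.vec_eq_iff ij)
    have sa: "(a *v v) \<bullet> w = v \<bullet> (a *v w)" for v w
      by (metis dot_lmul_matrix sym transpose_matrix_vector)
    have psd': "0 \<le> ((a - R) *v v) \<bullet> v" for v
    proof -
      \<comment> \<open>Subtracting \<open>s\<close> times the \<open>p\<close>-th unit vector minimises the form of \<open>a\<close> on the line through \<open>v\<close> in that
      direction; the minimum is the form of \<open>a - R\<close> at \<open>v\<close>.\<close>
    define s where "s = (c \<bullet> v) / d"
      have "((a - R) *v v) \<bullet> v = (a *v v) \<bullet> v - s * (c \<bullet> v)"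
        by (simp add: matrix_vector_mult_diff_rdistrib Rv s_def inner_diff_left)
      also have "\<dots> = (a *v (v - s *\<^sub>R axis p 1)) \<bullet> (v - s *\<^sub>R axis p 1)"
      proof -
        have "axis p 1 \<bullet> (a *v v) = c \<bullet> v" by (metis sa ac)
        moreover have "c $ p = d" by (simp add: c_def d_def)
        ultimately show ?thesis using pp
          by (simp add: matrix_vector_mult_diff_distrib matrix_vector_mult_scaleR ac inner_diff_left
            inner_diff_right inner_commute inner_axis d_def[symmetric] s_def)
      qed
      finally show ?thesis using psd by simp
    qed
    have sym': "transpose (a - R) = a - R"
      by (simp add: transpose_def Finite_Cartesian_Product.vec_eq_iff R_def ij)
    have "{i. (a - R) $ i \<noteq> 0} \<subset> {i. a $ i \<noteq> 0}"
    proof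
      have *: "(a - R) $ i = a $ i - (c $ i / d) *\<^sub>R c" for i
        by (simp add: R_def Finite_Cartesian_Product.vec_eq_iff)
      have "c $ i = 0" if "a $ i = 0" for i using that ij[of p i] by (simp add: c_def)
      then show "{i. (a - R) $ i \<noteq> 0} \<subseteq> {i. a $ i \<noteq> 0}" unfolding * by auto
      have "(a - R) $ p = 0" unfolding * using pp by (simp add: c_def d_def)
      then show "{i. (a - R) $ i \<noteq> 0} \<noteq> {i. a $ i \<noteq> 0}" using p by blast
    qed
    then have "card {i. (a - R) $ i \<noteq> 0} < card {i. a $ i \<noteq> 0}"
      by (intro psubset_card_mono) auto
    then have "0 \<le> hess_trace (a - R) H" using less.hyps[OF _ sym' psd'] by blast
    moreover have "hess_trace a H = hess_trace (a - R) H + hess_trace R H"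
      by (simp add: hess_trace_def sum.distrib[symmetric] matrix_vector_mult_diff_rdistrib)
    moreover have "hess_trace R H = (H c \<bullet> c) / d"
    proof -
      have c: "c = (\<Sum>i\<in>UNIV. c $ i *\<^sub>R axis i 1)"
        by (simp add: basis_expansion flip: scalar_mult_eq_scaleR)
      have "H c = (\<Sum>i\<in>UNIV. c $ i *\<^sub>R H (axis i 1))"
        by (subst c) (simp add: linear_sum[OF lin] linear_cmul[OF lin])
      then show ?thesis
        by (simp add: hess_trace_def Rv inner_sum_left inner_sum_right sum_divide_distrib inner_commute mult_ac)
    qed
    moreover have "0 \<le> (H c \<bullet> c) / d" using H pp by (simp add: d_def)
    ultimately show ?thesis by simp
  qed
qed

text \<open>
  If the second derivative in the direction \<open>v\<close> were negative, the function would decrease strictly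
  along \<open>v\<close>, because its first derivative vanishes at the minimum.
\<close>

lemma second_derivative_test:
  fixes g :: "real ^ 'n \<Rightarrow> real"
  assumes g: "\<And>y. (g has_derivative (\<lambda>h. G y \<bullet> h)) (at y)" and H: "(G has_derivative H) (at x)"
    and e: "e > 0" and min: "\<And>y. y \<in> ball x e \<Longrightarrow> g x \<le> g y"
  shows "0 \<le> H v \<bullet> v"
proof -
  have line: "((\<lambda>s. x + s *\<^sub>R v) has_derivative (\<lambda>h. h *\<^sub>R v)) (at s)" for s v
    by (auto intro!: derivative_eq_intros)
  have d1: "((\<lambda>s. g (x + s *\<^sub>R v)) has_real_derivative G (x + s *\<^sub>R v) \<bullet> v) (at s)" for s v
    using has_derivative_compose[OF line g] unfolding has_field_derivative_def
    by (simp add: mult_commute_abs)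
  have Hlin: "linear H" using H has_derivative_linear by blast
  have near: "g x \<le> g (x + s *\<^sub>R v)" if "\<bar>s\<bar> < e / (norm v + 1)" for s v
  proof (rule min)
    have "norm (s *\<^sub>R v) \<le> \<bar>s\<bar> * (norm v + 1)" by (simp add: algebra_simps)
    also have "\<dots> < e" using that by (subst (asm) pos_less_divide_eq) (simp_all add: add_nonneg_pos)
    finally show "x + s *\<^sub>R v \<in> ball x e" by (simp add: dist_norm)
  qed
  have ev: "0 < e / (norm v + 1)" for v :: "real ^ 'n" using e by (simp add: add_nonneg_pos)
  have zero: "G x \<bullet> v = 0" for v
    using DERIV_local_min[OF d1[of v 0] ev[of v]] near[of _ v] by simp
  from zero[of "G x"] have G0: "G x = 0" by simp
  show "0 \<le> H v \<bullet> v"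
  proof (rule ccontr)
    assume neg: "\<not> 0 \<le> H v \<bullet> v"
    have "((\<lambda>s. G (x + s *\<^sub>R v)) has_derivative (\<lambda>h. H (h *\<^sub>R v))) (at 0)"
      using has_derivative_compose[OF line[of v 0], of G H] H by simp
    then have "((\<lambda>s. G (x + s *\<^sub>R v) \<bullet> v) has_derivative (\<lambda>h. H (h *\<^sub>R v) \<bullet> v)) (at 0)"
      by (rule has_derivative_inner_left)
    then have "((\<lambda>s. G (x + s *\<^sub>R v) \<bullet> v) has_real_derivative H v \<bullet> v) (at 0)"
      unfolding has_field_derivative_def by (simp add: linear_cmul[OF Hlin] mult_commute_abs)
    from DERIV_neg_dec_right[OF this] neg obtain d where d: "d > 0"
      "\<And>h. 0 < h \<Longrightarrow> h < d \<Longrightarrow> G (x + h *\<^sub>R v) \<bullet> v < 0"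
      by (auto simp: G0)
    define k where "k = e / (norm v + 1)"
    define s where "s = min (d / 2) (k / 2)"
    have s: "0 < s" "s < d" "\<bar>s\<bar> < e / (norm v + 1)"
      using d(1) ev[of v] unfolding k_def[symmetric] by (auto simp: s_def min_def)
    obtain z where z: "0 < z" "z < s" "g (x + s *\<^sub>R v) - g (x + 0 *\<^sub>R v) = (s - 0) * (G (x + z *\<^sub>R v) \<bullet> v)"
      using MVT2[OF s(1), of "\<lambda>s. g (x + s *\<^sub>R v)" "\<lambda>s. G (x + s *\<^sub>R v) \<bullet> v"] d1 by auto
    have "(s - 0) * (G (x + z *\<^sub>R v) \<bullet> v) < 0"
      using z s d(2)[of z] by (simp add: mult_pos_neg)
    then show False using near[OF s(3)] z(3) by simp
  qed
qed

section \<open>A minimum principle for the heat equation\<close>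

text \<open>
  Pointwise solutions of \<open>\<partial>\<^sub>t w = 1/2 tr (a(t) D\<^sup>2 w)\<close> for \<open>t > t0\<close>.  Only \<open>w\<close> itself is required to be
  jointly continuous, which is all that the minimum principle uses; this spares a proof of
  continuity for the derivatives of the auxiliary solutions below.
\<close>

definition heat_solution :: "(real \<Rightarrow> real ^ 'n ^ 'n) \<Rightarrow> real \<Rightarrow> (real ^ 'n \<Rightarrow> real \<Rightarrow> real) \<Rightarrow> bool" where
  "heat_solution a t0 w \<longleftrightarrow>
     continuous_on (UNIV \<times> {t0<..}) (\<lambda>(x, t). w x t) \<and>
     (\<forall>t>t0. \<exists>G. (\<forall>y. ((\<lambda>y. w y t) has_derivative (\<lambda>h. G y \<bullet> h)) (at y)) \<and>
        (\<forall>x. \<exists>H. (G has_derivative H) (at x) \<and>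
                  (w x has_real_derivative 1 / 2 * hess_trace (a t) H) (at t)))"

lemma heat_solution_add:
  assumes "heat_solution a t0 v" "heat_solution a t0 w"
  shows "heat_solution a t0 (\<lambda>x t. v x t + w x t)"
  unfolding heat_solution_def
proof (intro conjI allI impI)
  show "continuous_on (UNIV \<times> {t0<..}) (\<lambda>(x, t). v x t + w x t)"
    using assms continuous_on_add unfolding heat_solution_def by (fastforce simp: split_beta)
next
  fix t assume "t > t0"
  then obtain G K where G: "\<And>y. ((\<lambda>y. v y t) has_derivative (\<lambda>h. G y \<bullet> h)) (at y)"
      "\<forall>x. \<exists>H. (G has_derivative H) (at x) \<and> (v x has_real_derivative 1 / 2 * hess_trace (a t) H) (at t)"
    and K: "\<And>y. ((\<lambda>y. w y t) has_derivative (\<lambda>h. K y \<bullet> h)) (at y)"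
      "\<forall>x. \<exists>H. (K has_derivative H) (at x) \<and> (w x has_real_derivative 1 / 2 * hess_trace (a t) H) (at t)"
    using assms unfolding heat_solution_def by metis
  show "\<exists>G. (\<forall>y. ((\<lambda>y. v y t + w y t) has_derivative (\<lambda>h. G y \<bullet> h)) (at y)) \<and>
        (\<forall>x. \<exists>H. (G has_derivative H) (at x) \<and>
                  ((\<lambda>t. v x t + w x t) has_real_derivative 1 / 2 * hess_trace (a t) H) (at t))"
  proof (rule exI[of _ "\<lambda>y. G y + K y"], intro conjI allI)
    show "((\<lambda>y. v y t + w y t) has_derivative (\<lambda>h. (G y + K y) \<bullet> h)) (at y)" for y
      using has_derivative_add[OF G(1) K(1)] by (simp add: inner_add_left)
    fix x
    obtain H where H: "(G has_derivative H) (at x)"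
      "(v x has_real_derivative 1 / 2 * hess_trace (a t) H) (at t)" using G(2) by blast
    obtain J where J: "(K has_derivative J) (at x)"
      "(w x has_real_derivative 1 / 2 * hess_trace (a t) J) (at t)" using K(2) by blast
    show "\<exists>H. ((\<lambda>y. G y + K y) has_derivative H) (at x) \<and>
                  ((\<lambda>t. v x t + w x t) has_real_derivative 1 / 2 * hess_trace (a t) H) (at t)"
      using has_derivative_add[OF H(1) J(1)] DERIV_add[OF H(2) J(2)]
      by (auto simp: hess_trace_add distrib_left add_divide_distrib intro!: exI[of _ "\<lambda>h. H h + J h"])
  qed
qed

lemma heat_solution_cmult:
  assumes "heat_solution a t0 v"
  shows "heat_solution a t0 (\<lambda>x t. c * v x t)"
  unfolding heat_solution_def
proof (intro conjI allI impI)
  show "continuous_on (UNIV \<times> {t0<..}) (\<lambda>(x, t). c * v x t)"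
    using assms continuous_on_mult_left unfolding heat_solution_def by (fastforce simp: split_beta)
next
  fix t assume "t > t0"
  then obtain G where G: "\<And>y. ((\<lambda>y. v y t) has_derivative (\<lambda>h. G y \<bullet> h)) (at y)"
      "\<forall>x. \<exists>H. (G has_derivative H) (at x) \<and> (v x has_real_derivative 1 / 2 * hess_trace (a t) H) (at t)"
    using assms unfolding heat_solution_def by metis
  show "\<exists>G. (\<forall>y. ((\<lambda>y. c * v y t) has_derivative (\<lambda>h. G y \<bullet> h)) (at y)) \<and>
        (\<forall>x. \<exists>H. (G has_derivative H) (at x) \<and>
                  ((\<lambda>t. c * v x t) has_real_derivative 1 / 2 * hess_trace (a t) H) (at t))"
  proof (rule exI[of _ "\<lambda>y. c *\<^sub>R G y"], intro conjI allI)
    show "((\<lambda>y. c * v y t) has_derivative (\<lambda>h. (c *\<^sub>R G y) \<bullet> h)) (at y)" for y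
      using has_derivative_mult_right[OF G(1), of c] by simp
    fix x
    obtain H where H: "(G has_derivative H) (at x)"
      "(v x has_real_derivative 1 / 2 * hess_trace (a t) H) (at t)" using G(2) by blast
    show "\<exists>H. ((\<lambda>y. c *\<^sub>R G y) has_derivative H) (at x) \<and>
                  ((\<lambda>t. c * v x t) has_real_derivative 1 / 2 * hess_trace (a t) H) (at t)"
      using has_derivative_scaleR_right[OF H(1), of c] DERIV_cmult[OF H(2), of c]
      by (auto simp: hess_trace_scaleR mult_ac)
  qed
qed

text \<open>
  The time interval depends on the point \<open>z\<close>; a finite subcover of \<open>S\<close> makes it uniform.
\<close>

lemma initial_bound_uniform:
  fixes w :: "real ^ 'n \<Rightarrow> real \<Rightarrow> real"
  assumes init: "\<And>z. \<forall>\<^sub>F p in at (z, t0) within UNIV \<times> {t0<..}. - e \<le> w (fst p) (snd p)"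
    and "compact S"
  obtains d where "d > 0" "\<And>y t. y \<in> S \<Longrightarrow> t0 < t \<Longrightarrow> t < t0 + d \<Longrightarrow> - e \<le> w y t"
proof -
  have "\<exists>d>0. \<forall>y t. t0 < t \<longrightarrow> dist (y, t) (z, t0) < d \<longrightarrow> - e \<le> w y t" for z
    using init[of z] unfolding eventually_at by (metis Pair_inject SigmaI UNIV_I fst_conv greaterThan_iff less_irrefl snd_conv)
  then obtain d where d: "\<And>z. d z > 0"
    "\<And>z y t. t0 < t \<Longrightarrow> dist (y, t) (z, t0) < d z \<Longrightarrow> - e \<le> w y t" by metis
  have "S \<subseteq> (\<Union>z\<in>S. ball z (d z / 2))" using d(1) by force
  then obtain F where F: "F \<subseteq> S" "finite F" "S \<subseteq> (\<Union>z\<in>F. ball z (d z / 2))"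
    using compactE_image[OF \<open>compact S\<close>, of S "\<lambda>z. ball z (d z / 2)"] by auto
  define m where "m = Min (insert 1 ((\<lambda>z. d z / 2) ` F))"
  have m: "m > 0" using F(2) d(1) by (auto simp: m_def)
  have m2: "m \<le> d z / 2" if "z \<in> F" for z unfolding m_def using F(2) that by (intro Min_le) auto
  show ?thesis
  proof (rule that[OF m])
    fix y t assume y: "y \<in> S" and t: "t0 < t" "t < t0 + m"
    obtain z where z: "z \<in> F" "dist z y < d z / 2" using F(3) y by auto
    have "dist (y, t) (z, t0) \<le> dist y z + dist t t0"
      by (simp add: dist_Pair_Pair sqrt_sum_squares_le_sum)
    also have "\<dots> < d z" using z t m2[OF z(1)] by (simp add: dist_commute dist_real_def)
    finally show "- e \<le> w y t" using d(2) t by blast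
  qed
qed

text \<open>
  The perturbation \<open>w + \<eta> (x \<bullet> x + L (t - t0))\<close> with \<open>L > tr a\<close> is a strict supersolution that is large
  for large \<open>x\<close>.  If \<open>w\<close> were negative somewhere, the perturbation would have a negative minimum on a
  compact cylinder, away from its bottom and its lateral boundary.  There the time derivative is
  at most \<open>0\<close> and the second-order term at least \<open>0\<close>, against strictness.  The initial condition is a
  lower limit at every point \<open>(z, t0)\<close>, so that \<open>w\<close> need not be defined continuously up to \<open>t0\<close>.
\<close>

lemma heat_minimum_principle:
  fixes w :: "real ^ 'n \<Rightarrow> real \<Rightarrow> real"
  assumes sol: "heat_solution a t0 w"
    and sym: "\<And>t. t0 < t \<Longrightarrow> transpose (a t) = a t"
    and psd: "\<And>t v. t0 < t \<Longrightarrow> 0 \<le> (a t *v v) \<bullet> v"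
    and tr: "\<And>t. t0 < t \<Longrightarrow> t \<le> T \<Longrightarrow> trace (a t) \<le> K"
    and lower: "\<And>x t. t0 < t \<Longrightarrow> t \<le> T \<Longrightarrow> - M \<le> w x t"
    and init: "\<And>z e. e > 0 \<Longrightarrow>
       \<forall>\<^sub>F p in at (z, t0) within UNIV \<times> {t0<..}. - e \<le> w (fst p) (snd p)"
    and "t0 < t1" "t1 \<le> T"
  shows "0 \<le> w x1 t1"
proof (rule ccontr)
  assume neg: "\<not> 0 \<le> w x1 t1"
  define L where "L = max K 0 + 1"
  have L: "L > K" "L > 0" by (auto simp: L_def)
  define b where "b x t = x \<bullet> x + L * (t - t0)" for x :: "real ^ 'n" and t
  \<comment> \<open>\<open>\<eta>\<close> is so small that the perturbed function at \<open>(x1, t1)\<close> lies even below \<open>- \<eta>\<close>, the tolerance that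
    is used for the initial condition.\<close>
  define \<eta> where "\<eta> = - w x1 t1 / (2 * (b x1 t1 + 1))"
  have b1: "b x1 t1 \<ge> 0" using L \<open>t0 < t1\<close> by (simp add: b_def)
  have \<eta>: "\<eta> > 0" using neg b1 by (simp add: \<eta>_def divide_neg_pos)
  have start: "w x1 t1 + \<eta> * b x1 t1 < - \<eta>"
  proof -
    have "- w / (2 * k) * k = - w / 2" if "k \<noteq> 0" for w k :: real using that by simp
    from this[of "b x1 t1 + 1"] have "\<eta> * (b x1 t1 + 1) = - w x1 t1 / 2" using b1 by (simp add: \<eta>_def)
    then show ?thesis using neg by (simp add: algebra_simps)
  qed
  \<comment> \<open>On the lateral boundary \<open>\<eta> R\<^sup>2 \<ge> \<eta> R \<ge> \<bar>M\<bar>\<close> makes the perturbed function nonnegative.\<close>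
  define R where "R = norm x1 + 1 + \<bar>M\<bar> / \<eta>"
  have R: "norm x1 < R" "\<bar>M\<bar> \<le> \<eta> * R" "1 \<le> R"
    using \<eta> by (auto simp: R_def field_simps add_pos_nonneg add_nonneg_pos)
  obtain d where d: "d > 0" "\<And>y t. y \<in> cball 0 R \<Longrightarrow> t0 < t \<Longrightarrow> t < t0 + d \<Longrightarrow> - \<eta> \<le> w y t"
    using initial_bound_uniform[OF init[OF \<eta>] compact_cball] by metis
  define d' where "d' = min (d / 2) ((t1 - t0) / 2)"
  have d': "0 < d'" "d' < d" "t0 + d' < t1"
    using d(1) \<open>t0 < t1\<close> by (auto simp: d'_def min_def field_simps)
  define S where "S = cball (0 :: real ^ 'n) R \<times> {t0 + d'..t1}"
  define \<omega> where "\<omega> x t = w x t + \<eta> * b x t" for x t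
  have "continuous_on S (\<lambda>(x, t). w x t)"
    using sol d' unfolding heat_solution_def S_def
    by (elim conjE) (rule continuous_on_subset, auto)
  then have "continuous_on S (\<lambda>p. \<omega> (fst p) (snd p))"
    unfolding \<omega>_def b_def split_beta by (intro continuous_intros)
  moreover have "compact S" "S \<noteq> {}" unfolding S_def using R d' by (auto intro!: compact_Times simp: not_le)
  ultimately obtain p where p: "p \<in> S" "\<And>q. q \<in> S \<Longrightarrow> \<omega> (fst p) (snd p) \<le> \<omega> (fst q) (snd q)"
    using continuous_attains_inf[of S "\<lambda>p. \<omega> (fst p) (snd p)"] by blast
  obtain x \<tau> where x: "p = (x, \<tau>)" by (cases p)
  have "(x1, t1) \<in> S" using R d' by (simp add: S_def)
  from p(2)[OF this] start have low: "\<omega> x \<tau> < - \<eta>" by (simp add: x \<omega>_def)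
  have xR: "norm x \<le> R" and \<tau>: "t0 + d' \<le> \<tau>" "\<tau> \<le> t1" using p(1) by (auto simp: S_def x)
  have \<tau>0: "t0 < \<tau>" "\<tau> \<le> T" using \<tau> d' \<open>t1 \<le> T\<close> by auto
  have "norm x \<noteq> R"
  proof
    assume "norm x = R"
    then have "\<eta> * (R * R) \<le> \<eta> * b x \<tau>"
      using \<eta> L \<tau>0 by (simp add: b_def dot_square_norm power2_eq_square)
    moreover have "\<eta> * R * 1 \<le> \<eta> * R * R" using \<eta> R by (intro mult_left_mono) auto
    ultimately have "0 \<le> \<omega> x \<tau>" using lower[OF \<tau>0, of x] R(2) by (simp add: \<omega>_def mult.assoc)
    then show False using low \<eta> by simp
  qed
  then have xR: "norm x < R" using xR by simp
  have "t0 + d' \<noteq> \<tau>"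
  proof
    assume "t0 + d' = \<tau>"
    then have "- \<eta> \<le> w x \<tau>" using d(2)[of x \<tau>] xR d' by simp
    moreover have "0 \<le> \<eta> * b x \<tau>" using \<eta> L \<tau>0 by (simp add: b_def)
    ultimately show False using low by (simp add: \<omega>_def)
  qed
  then have \<tau>d: "t0 + d' < \<tau>" using \<tau> by simp
  obtain G H where G: "\<And>y. ((\<lambda>y. w y \<tau>) has_derivative (\<lambda>h. G y \<bullet> h)) (at y)"
    and H: "(G has_derivative H) (at x)"
    and wt: "(w x has_real_derivative 1 / 2 * hess_trace (a \<tau>) H) (at \<tau>)"
    using sol \<tau>0 unfolding heat_solution_def by metis
  have G': "((\<lambda>y. \<omega> y \<tau>) has_derivative (\<lambda>h. (G y + (2 * \<eta>) *\<^sub>R y) \<bullet> h)) (at y)" for y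
  proof -
    have "((\<lambda>y. y \<bullet> y) has_derivative (\<lambda>h. 2 * (y \<bullet> h))) (at y)"
      using has_derivative_inner[OF has_derivative_ident has_derivative_ident, of y] by (simp add: inner_commute)
    from has_derivative_add[OF G has_derivative_add[OF has_derivative_mult_right[OF this, of \<eta>]
        has_derivative_const[of "\<eta> * (L * (\<tau> - t0))"]]]
    show ?thesis unfolding \<omega>_def b_def by (simp add: inner_add_left distrib_left mult_ac)
  qed
  have H': "((\<lambda>y. G y + (2 * \<eta>) *\<^sub>R y) has_derivative (\<lambda>h. H h + (2 * \<eta>) *\<^sub>R h)) (at x)"
    using has_derivative_add[OF H has_derivative_scaleR_right[OF has_derivative_ident, of "2 * \<eta>"]] by simp
  have min: "\<omega> x \<tau> \<le> \<omega> y \<tau>" if "y \<in> ball x (R - norm x)" for y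
  proof -
    have "norm y \<le> norm x + dist x y" using norm_triangle_sub[of y x] by (simp add: dist_norm norm_minus_commute)
    then have "(y, \<tau>) \<in> S" using that \<tau> by (simp add: S_def)
    from p(2)[OF this] show ?thesis by (simp add: x)
  qed
  \<comment> \<open>At the interior minimum the Hessian is positive semidefinite and the time derivative, taken from
    the left, is at most \<open>0\<close>.\<close>
  have "0 \<le> (H v + (2 * \<eta>) *\<^sub>R v) \<bullet> v" for v
    by (rule second_derivative_test[OF G' H', of "R - norm x"]) (use xR min in auto)
  then have "0 \<le> hess_trace (a \<tau>) (\<lambda>h. H h + (2 * \<eta>) *\<^sub>R h)"
    by (intro hess_trace_nonneg sym psd \<tau>0 has_derivative_linear[OF H'])
  moreover have "hess_trace (a \<tau>) (\<lambda>h. h) = trace (a \<tau>)"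
    by (simp add: hess_trace_def trace_def matrix_vector_mult_basis column_def)
  ultimately have "0 \<le> hess_trace (a \<tau>) H + 2 * \<eta> * trace (a \<tau>)"
    by (simp add: hess_trace_add hess_trace_scaleR)
  moreover have d: "((\<lambda>t. \<omega> x t) has_real_derivative 1 / 2 * hess_trace (a \<tau>) H + \<eta> * L) (at \<tau>)"
    unfolding \<omega>_def b_def by (rule derivative_eq_intros wt | simp)+
  have "1 / 2 * hess_trace (a \<tau>) H + \<eta> * L \<le> 0"
  proof (rule ccontr)
    assume "\<not> 1 / 2 * hess_trace (a \<tau>) H + \<eta> * L \<le> 0"
    with DERIV_pos_inc_left[OF d] obtain k where k: "k > 0"
      "\<And>h. 0 < h \<Longrightarrow> h < k \<Longrightarrow> \<omega> x (\<tau> - h) < \<omega> x \<tau>" by auto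
    define h where "h = min (k / 2) (\<tau> - (t0 + d'))"
    have h: "0 < h" "h < k" "t0 + d' \<le> \<tau> - h" using k(1) \<tau>d by (auto simp: h_def)
    have "(x, \<tau> - h) \<in> S" using h \<tau> xR by (simp add: S_def)
    from p(2)[OF this] k(2)[OF h(1,2)] show False by (simp add: x)
  qed
  moreover have "\<eta> * trace (a \<tau>) \<le> \<eta> * K" using tr[OF \<tau>0] \<eta> by simp
  moreover have "\<eta> * K < \<eta> * L" using L \<eta> by simp
  ultimately show False by linarith
qed

section \<open>Gaussian shifts of solutions\<close>

text \<open>
  Solutions with explicitly named gradient \<open>G\<close> and Hessian \<open>H\<close>, all jointly continuous.  The continuity of
  \<open>G\<close> gives the chain rule along moving points, and that of \<open>H\<close> allows differentiation under integrals.
\<close>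

definition smooth_heat_solution ::
  "(real \<Rightarrow> real ^ 'n ^ 'n) \<Rightarrow> real \<Rightarrow> (real ^ 'n \<Rightarrow> real \<Rightarrow> real) \<Rightarrow> (real ^ 'n \<Rightarrow> real \<Rightarrow> real ^ 'n) \<Rightarrow>
   (real ^ 'n \<Rightarrow> real \<Rightarrow> real ^ 'n ^ 'n) \<Rightarrow> bool" where
  "smooth_heat_solution a t0 w G H \<longleftrightarrow>
     (\<forall>x. \<forall>t>t0. ((\<lambda>y. w y t) has_derivative (\<lambda>h. G x t \<bullet> h)) (at x) \<and>
        ((\<lambda>y. G y t) has_derivative (*v) (H x t)) (at x) \<and>
        (w x has_real_derivative 1 / 2 * trace (a t ** H x t)) (at t)) \<and>
     continuous_on (UNIV \<times> {t0<..}) (\<lambda>(x, t). w x t) \<and>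
     continuous_on (UNIV \<times> {t0<..}) (\<lambda>(x, t). G x t) \<and>
     continuous_on (UNIV \<times> {t0<..}) (\<lambda>(x, t). H x t)"

lemma smooth_heat_solutionD:
  assumes "smooth_heat_solution a t0 w G H" "t0 < t"
  shows "((\<lambda>y. w y t) has_derivative (\<lambda>h. G x t \<bullet> h)) (at x)"
    "((\<lambda>y. G y t) has_derivative (*v) (H x t)) (at x)"
    "(w x has_real_derivative 1 / 2 * trace (a t ** H x t)) (at t)"
  using assms unfolding smooth_heat_solution_def by simp_all

lemma smooth_heat_solution_continuous:
  assumes "smooth_heat_solution a t0 w G H"
  shows "continuous_on (UNIV \<times> {t0<..}) (\<lambda>(x, t). w x t)"
     "continuous_on (UNIV \<times> {t0<..}) (\<lambda>(x, t). G x t)"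
     "continuous_on (UNIV \<times> {t0<..}) (\<lambda>(x, t). H x t)"
  using assms unfolding smooth_heat_solution_def by simp_all

lemma smooth_heat_solution_imp_heat_solution:
  assumes "smooth_heat_solution a t0 w G H" "t0 \<le> s"
  shows "heat_solution a s w"
  unfolding heat_solution_def
proof (intro conjI allI impI)
  show "continuous_on (UNIV \<times> {s<..}) (\<lambda>(x, t). w x t)"
    by (rule continuous_on_subset[OF smooth_heat_solution_continuous(1)[OF assms(1)]]) (use assms(2) in auto)
  fix t assume "s < t"
  then have t: "t0 < t" using assms(2) by simp
  show "\<exists>G. (\<forall>y. ((\<lambda>y. w y t) has_derivative (\<lambda>h. G y \<bullet> h)) (at y)) \<and>
         (\<forall>x. \<exists>H. (G has_derivative H) (at x) \<and> (w x has_real_derivative 1 / 2 * hess_trace (a t) H) (at t))"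
  proof (rule exI[of _ "\<lambda>y. G y t"], intro conjI allI)
    fix x
    show "((\<lambda>y. w y t) has_derivative (\<lambda>h. G x t \<bullet> h)) (at x)"
      by (rule smooth_heat_solutionD(1)[OF assms(1) t])
    show "\<exists>H. ((\<lambda>y. G y t) has_derivative H) (at x) \<and> (w x has_real_derivative 1 / 2 * hess_trace (a t) H) (at t)"
      using smooth_heat_solutionD(2,3)[OF assms(1) t, of x]
      by (intro exI[of _ "(*v) (H x t)"]) (simp add: hess_trace_matrix)
  qed
qed

text \<open>
  The chain rule needs joint differentiability in space and time, which follows from the partial
  derivatives because the gradient is continuous.
\<close>

lemma has_real_derivative_along_curve:
  fixes w :: "real ^ 'n \<Rightarrow> real \<Rightarrow> real"
  assumes G: "\<And>y \<tau>. t0 < \<tau> \<Longrightarrow> ((\<lambda>y. w y \<tau>) has_derivative (\<lambda>h. G y \<tau> \<bullet> h)) (at y)"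
    and cont: "continuous_on (UNIV \<times> {t0<..}) (\<lambda>(y, \<tau>). G y \<tau>)"
    and wt: "(w (z t) has_real_derivative D) (at t)"
    and z: "(z has_vector_derivative z') (at t)" and t: "t0 < t"
  shows "((\<lambda>\<tau>. w (z \<tau>) \<tau>) has_real_derivative D + G (z t) t \<bullet> z') (at t)"
proof -
  have op: "open ({t0<..} \<times> (UNIV :: (real ^ 'n) set))" by (intro open_Times) auto
  have swap: "continuous_on ({t0<..} \<times> UNIV) (\<lambda>(\<tau>, y). G y \<tau>)"
    using continuous_on_compose2[OF cont, of "{t0<..} \<times> UNIV" "\<lambda>p. (snd p, fst p)"]
    by (force simp: split_beta intro!: continuous_intros)
  have "((\<lambda>(\<tau>, y). w y \<tau>) has_derivative
      (\<lambda>(s, h). s * D + blinfun_apply (blinfun_inner_right (G (z t) t)) h)) (at (t, z t) within {t0<..} \<times> UNIV)"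
  proof (rule has_derivative_partialsI)
    show "((\<lambda>\<tau>. w (z t) \<tau>) has_derivative (\<lambda>s. s * D)) (at t within {t0<..})"
      using wt by (simp add: has_field_derivative_def mult_commute_abs has_derivative_at_withinI)
    show "((\<lambda>y. w y \<tau>) has_derivative blinfun_apply (blinfun_inner_right (G y \<tau>))) (at y)"
      if "\<tau> \<in> {t0<..}" for y \<tau> using G that by simp
    have "continuous_on ({t0<..} \<times> UNIV) (\<lambda>(\<tau>, y). blinfun_inner_right (G y \<tau>))"
      using bounded_linear.continuous_on[OF bounded_linear_blinfun_inner_right swap] by (simp add: split_beta)
    then show "continuous (at (t, z t) within {t0<..} \<times> UNIV) (\<lambda>(\<tau>, y). blinfun_inner_right (G y \<tau>))"
      using t by (simp add: continuous_on_eq_continuous_within)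
  qed auto
  then have joint: "((\<lambda>(\<tau>, y). w y \<tau>) has_derivative (\<lambda>(s, h). s * D + G (z t) t \<bullet> h)) (at (t, z t))"
    using at_within_open[OF _ op, of "(t, z t)"] t by simp
  have "((\<lambda>\<tau>. (\<tau>, z \<tau>)) has_derivative (\<lambda>s. (s, s *\<^sub>R z'))) (at t)"
    using z unfolding has_vector_derivative_def by (intro has_derivative_Pair has_derivative_ident)
  from has_derivative_compose[OF this joint]
  have "((\<lambda>\<tau>. w (z \<tau>) \<tau>) has_derivative (\<lambda>s. s * D + G (z t) t \<bullet> (s *\<^sub>R z'))) (at t)" by simp
  then show ?thesis unfolding has_field_derivative_def
    by (rule has_derivative_eq_rhs) (simp add: fun_eq_iff algebra_simps)
qed

text \<open>
  The invariance of the heat equation under Gaussian shifts.  Since \<open>\<Gamma>' = a\<close>, moving the argument by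
  \<open>\<Gamma> \<theta>\<close> produces the term \<open>\<langle>a \<theta>, D w\<rangle>\<close>, which is the mixed term that the exponential factor contributes to the
  Hessian, and the exponent \<open>1/2 \<langle>\<Gamma> \<theta>, \<theta>\<rangle>\<close> accounts for the term of second order in \<open>\<theta>\<close>.  For constant
  \<open>w\<close> this yields the exponential solutions.
\<close>

lemma heat_solution_exp_shift:
  fixes w :: "real ^ 'n \<Rightarrow> real \<Rightarrow> real"
  assumes sol: "smooth_heat_solution a t0 w G H" and s: "t0 \<le> s"
    and sym: "\<And>t. s < t \<Longrightarrow> transpose (a t) = a t"
    and \<Gamma>: "\<And>t. s < t \<Longrightarrow> (\<Gamma> has_vector_derivative a t) (at t)"
  shows "heat_solution a s (\<lambda>x t. exp (\<theta> \<bullet> x + \<kappa> + 1 / 2 * ((\<Gamma> t *v \<theta>) \<bullet> \<theta>)) * w (x + \<Gamma> t *v \<theta>) t)"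
  unfolding heat_solution_def
proof (intro conjI allI impI)
  have "continuous_on {s<..} \<Gamma>"
    by (intro continuous_at_imp_continuous_on ballI has_vector_derivative_continuous[OF \<Gamma>]) auto
  then have c\<Gamma>: "continuous_on (UNIV \<times> {s<..}) (\<lambda>p :: (real ^ 'n) \<times> real. \<Gamma> (snd p))"
    by (rule continuous_on_compose2) (auto intro!: continuous_intros)
  have "continuous_on (UNIV \<times> {s<..}) (\<lambda>p. w (fst p + \<Gamma> (snd p) *v \<theta>) (snd p))"
    using continuous_on_compose2[OF smooth_heat_solution_continuous(1)[OF sol], of "UNIV \<times> {s<..}"
        "\<lambda>p. (fst p + \<Gamma> (snd p) *v \<theta>, snd p)"] s
    by (force simp: split_beta intro!: continuous_intros c\<Gamma>)
  then show "continuous_on (UNIV \<times> {s<..})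
     (\<lambda>(x, t). exp (\<theta> \<bullet> x + \<kappa> + 1 / 2 * ((\<Gamma> t *v \<theta>) \<bullet> \<theta>)) * w (x + \<Gamma> t *v \<theta>) t)"
    unfolding split_beta by (intro continuous_intros c\<Gamma>)
next
  fix t assume st: "s < t"
  then have t: "t0 < t" using s by simp
  define q where "q = \<Gamma> t *v \<theta>"
  define E where "E y = exp (\<theta> \<bullet> y + \<kappa> + 1 / 2 * (q \<bullet> \<theta>))" for y
  have line: "((\<lambda>y. y + q) has_derivative (\<lambda>h. h)) (at y)" for y
    by (auto intro!: derivative_eq_intros)
  have dw: "((\<lambda>y. w (y + q) t) has_derivative (\<lambda>h. G (y + q) t \<bullet> h)) (at y)" for y
    using has_derivative_compose[OF line smooth_heat_solutionD(1)[OF sol t]] by simp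
  have dG: "((\<lambda>y. G (y + q) t) has_derivative (\<lambda>h. H (y + q) t *v h)) (at y)" for y
    using has_derivative_compose[OF line smooth_heat_solutionD(2)[OF sol t]] by simp
  have dE: "(E has_derivative (\<lambda>h. E y * (\<theta> \<bullet> h))) (at y)" for y
    unfolding E_def by (auto intro!: derivative_eq_intros)
  show "\<exists>G. (\<forall>y. ((\<lambda>y. exp (\<theta> \<bullet> y + \<kappa> + 1 / 2 * ((\<Gamma> t *v \<theta>) \<bullet> \<theta>)) * w (y + \<Gamma> t *v \<theta>) t)
            has_derivative (\<lambda>h. G y \<bullet> h)) (at y)) \<and>
         (\<forall>x. \<exists>H. (G has_derivative H) (at x) \<and>
            ((\<lambda>t. exp (\<theta> \<bullet> x + \<kappa> + 1 / 2 * ((\<Gamma> t *v \<theta>) \<bullet> \<theta>)) * w (x + \<Gamma> t *v \<theta>) t)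
            has_real_derivative 1 / 2 * hess_trace (a t) H) (at t))"
    unfolding q_def[symmetric] E_def[symmetric]
  proof (rule exI[of _ "\<lambda>y. E y *\<^sub>R (w (y + q) t *\<^sub>R \<theta> + G (y + q) t)"], intro conjI allI)
    fix x
    define v where "v = w (x + q) t *\<^sub>R \<theta> + G (x + q) t"
    have "((\<lambda>y. E y * w (y + q) t) has_derivative (\<lambda>h. E x * (G (x + q) t \<bullet> h) + E x * (\<theta> \<bullet> h) * w (x + q) t)) (at x)"
      by (rule has_derivative_mult[OF dE dw])
    then show "((\<lambda>y. E y * w (y + q) t) has_derivative (\<lambda>h. (E x *\<^sub>R (w (x + q) t *\<^sub>R \<theta> + G (x + q) t)) \<bullet> h)) (at x)"
      by (simp add: inner_add_left algebra_simps)
    define J where "J h = (\<theta> \<bullet> h) *\<^sub>R (E x *\<^sub>R v) + E x *\<^sub>R ((G (x + q) t \<bullet> h) *\<^sub>R \<theta> + H (x + q) t *v h)" for h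
    have "((\<lambda>y. w (y + q) t *\<^sub>R \<theta> + G (y + q) t) has_derivative
        (\<lambda>h. (G (x + q) t \<bullet> h) *\<^sub>R \<theta> + H (x + q) t *v h)) (at x)"
      by (rule has_derivative_add[OF has_derivative_scaleR_left[OF dw] dG])
    from has_derivative_scaleR[OF dE this]
    have dJ: "((\<lambda>y. E y *\<^sub>R (w (y + q) t *\<^sub>R \<theta> + G (y + q) t)) has_derivative J) (at x)"
      by (rule has_derivative_eq_rhs) (simp add: J_def[abs_def] v_def algebra_simps)
    have tr: "hess_trace (a t) J = E x * (\<theta> \<bullet> (a t *v v) + (G (x + q) t \<bullet> (a t *v \<theta>) + trace (a t ** H (x + q) t)))"
      unfolding J_def[abs_def]
      by (simp only: hess_trace_add hess_trace_scaleR hess_trace_rank_one hess_trace_matrix)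
        (simp add: matrix_vector_mult_scaleR algebra_simps)
    have sa: "\<theta> \<bullet> (a t *v g) = g \<bullet> (a t *v \<theta>)" for g
      by (metis dot_lmul_matrix inner_commute sym[OF st] transpose_matrix_vector)
    have dz: "((\<lambda>\<tau>. \<Gamma> \<tau> *v \<theta>) has_vector_derivative a t *v \<theta>) (at t)"
      by (rule bounded_linear.has_vector_derivative[OF
            bounded_bilinear.bounded_linear_left[OF bounded_bilinear_matrix_vector_mult] \<Gamma>[OF st]])
    then have "((\<lambda>\<tau>. x + \<Gamma> \<tau> *v \<theta>) has_vector_derivative a t *v \<theta>) (at t)"
      by (auto intro!: derivative_eq_intros)
    from has_real_derivative_along_curve[of t0 w G, OF smooth_heat_solutionD(1)[OF sol]
        smooth_heat_solution_continuous(2)[OF sol] _ this t] smooth_heat_solutionD(3)[OF sol t]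
    have wt: "((\<lambda>\<tau>. w (x + \<Gamma> \<tau> *v \<theta>) \<tau>) has_real_derivative
        1 / 2 * trace (a t ** H (x + q) t) + G (x + q) t \<bullet> (a t *v \<theta>)) (at t)"
      by (simp add: q_def)
    have "((\<lambda>\<tau>. (\<Gamma> \<tau> *v \<theta>) \<bullet> \<theta>) has_vector_derivative (a t *v \<theta>) \<bullet> \<theta>) (at t)"
      by (rule bounded_linear.has_vector_derivative[OF bounded_linear_inner_left dz])
    then have "((\<lambda>\<tau>. (\<Gamma> \<tau> *v \<theta>) \<bullet> \<theta>) has_real_derivative (a t *v \<theta>) \<bullet> \<theta>) (at t)"
      by (simp add: has_real_derivative_iff_has_vector_derivative)
    then have "((\<lambda>\<tau>. exp (\<theta> \<bullet> x + \<kappa> + 1 / 2 * ((\<Gamma> \<tau> *v \<theta>) \<bullet> \<theta>))) has_real_derivative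
        E x * (1 / 2 * ((a t *v \<theta>) \<bullet> \<theta>))) (at t)"
      unfolding E_def q_def by (auto intro!: derivative_eq_intros)
    from DERIV_mult[OF this wt]
    have "((\<lambda>t. exp (\<theta> \<bullet> x + \<kappa> + 1 / 2 * ((\<Gamma> t *v \<theta>) \<bullet> \<theta>)) * w (x + \<Gamma> t *v \<theta>) t)
            has_real_derivative 1 / 2 * hess_trace (a t) J) (at t)"
      unfolding tr sa
      by (rule DERIV_cong) (simp add: E_def q_def v_def inner_add_left inner_commute algebra_simps)
    with dJ show "\<exists>H. ((\<lambda>y. E y *\<^sub>R (w (y + q) t *\<^sub>R \<theta> + G (y + q) t)) has_derivative H) (at x) \<and>
            ((\<lambda>t. exp (\<theta> \<bullet> x + \<kappa> + 1 / 2 * ((\<Gamma> t *v \<theta>) \<bullet> \<theta>)) * w (x + \<Gamma> t *v \<theta>) t)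
            has_real_derivative 1 / 2 * hess_trace (a t) H) (at t)"
      by blast
  qed
qed

lemma smooth_heat_solution_const: "smooth_heat_solution a t0 (\<lambda>x t. c) (\<lambda>x t. 0) (\<lambda>x t. 0)"
  unfolding smooth_heat_solution_def
  by (auto simp: trace_def fun_eq_iff[symmetric] intro!: derivative_eq_intros)

section \<open>The gradient estimate without drift\<close>

lemma heat_solution_later_start:
  assumes "heat_solution a t0 w" "t0 \<le> s"
  shows "heat_solution a s w"
proof -
  have "continuous_on (UNIV \<times> {s<..}) (\<lambda>(x, t). w x t)"
    by (rule continuous_on_subset[of "UNIV \<times> {t0<..}"]) (use assms in \<open>auto simp: heat_solution_def\<close>)
  then show ?thesis using assms by (simp add: heat_solution_def)
qed

text \<open>
  This is the weighted inequality of arithmetic and geometric means for \<open>1\<close> and \<open>exp b\<close>.  It is obtained by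
  averaging \<open>1 + x \<le> exp x\<close> at \<open>x = (1 - \<epsilon>) b\<close> and \<open>x = - \<epsilon> b\<close>.
\<close>

lemma exp_mult_le:
  fixes b \<epsilon> :: real
  assumes "0 \<le> \<epsilon>" "\<epsilon> \<le> 1"
  shows "exp (\<epsilon> * b) \<le> 1 + \<epsilon> * (exp b - 1)"
proof -
  have "exp (\<epsilon> * b) * (1 + (1 - \<epsilon>) * b) \<le> exp (\<epsilon> * b) * exp ((1 - \<epsilon>) * b)"
    by (intro mult_left_mono exp_ge_add_one_self) auto
  also have "\<dots> = exp b" by (simp add: algebra_simps flip: exp_add)
  finally have 1: "\<epsilon> * (exp (\<epsilon> * b) * (1 + (1 - \<epsilon>) * b)) \<le> \<epsilon> * exp b"
    using assms(1) by (rule mult_left_mono)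
  have "exp (\<epsilon> * b) * (1 + - (\<epsilon> * b)) \<le> exp (\<epsilon> * b) * exp (- (\<epsilon> * b))"
    by (intro mult_left_mono exp_ge_add_one_self) auto
  also have "\<dots> = 1" by (simp flip: exp_add)
  finally have 2: "(1 - \<epsilon>) * (exp (\<epsilon> * b) * (1 + - (\<epsilon> * b))) \<le> (1 - \<epsilon>) * 1"
    using assms(2) by (intro mult_left_mono) auto
  have "exp (\<epsilon> * b) = \<epsilon> * (exp (\<epsilon> * b) * (1 + (1 - \<epsilon>) * b)) + (1 - \<epsilon>) * (exp (\<epsilon> * b) * (1 + - (\<epsilon> * b)))"
    by (simp add: algebra_simps)
  then show ?thesis using 1 2 by (simp add: algebra_simps)
qed

lemma psd_of_psd_derivative:
  fixes \<Gamma> :: "real \<Rightarrow> real ^ 'n ^ 'n"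
  assumes \<Gamma>: "\<And>t. s \<le> t \<Longrightarrow> (\<Gamma> has_vector_derivative a t) (at t)"
    and psd: "\<And>t v. s \<le> t \<Longrightarrow> 0 \<le> (a t *v v) \<bullet> v"
    and "\<Gamma> s = 0" "s \<le> t"
  shows "0 \<le> (\<Gamma> t *v v) \<bullet> v"
proof -
  have d: "((\<lambda>t. (\<Gamma> t *v v) \<bullet> v) has_real_derivative (a t *v v) \<bullet> v) (at t)" if "s \<le> t" for t
    using bounded_linear.has_vector_derivative[OF bounded_linear_inner_left
        bounded_linear.has_vector_derivative[OF bounded_bilinear.bounded_linear_left[OF bounded_bilinear_matrix_vector_mult] \<Gamma>[OF that]]]
    by (simp add: has_real_derivative_iff_has_vector_derivative)
  have "(\<Gamma> s *v v) \<bullet> v \<le> (\<Gamma> t *v v) \<bullet> v"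
    by (rule DERIV_nonneg_imp_nondecreasing[OF \<open>s \<le> t\<close>]) (use d psd in blast)
  then show ?thesis using \<open>\<Gamma> s = 0\<close> by simp
qed

text \<open>
  With \<open>b = \<theta> \<bullet> z + \<kappa>\<close>, the inequality \<open>u (exp (\<epsilon> b) - 1) / \<epsilon> + u \<le> C exp b\<close> holds at time \<open>s\<close>, by
  \<open>exp_mult_le\<close> and \<open>0 < u \<le> C\<close>.  The functions \<open>exp (\<epsilon> b) u\<close>, \<open>u\<close> and \<open>exp b\<close> on its two sides
  continue to solutions by \<open>heat_solution_exp_shift\<close>, so the minimum principle carries the inequality to
  time \<open>T\<close>.  Its limit for \<open>\<epsilon> \<rightarrow> 0\<close> is the statement that is needed, but the solution that
  starts from \<open>b u\<close> involves the gradient of \<open>u\<close>, and to verify the equation for it would take third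
  derivatives of \<open>u\<close>.
\<close>

lemma heat_difference_quotient_bound:
  fixes u :: "real ^ 'n \<Rightarrow> real \<Rightarrow> real"
  assumes sol: "smooth_heat_solution a t0 u G H"
    and sym: "\<And>t. t0 < t \<Longrightarrow> transpose (a t) = a t"
    and psd: "\<And>t v. t0 < t \<Longrightarrow> 0 \<le> (a t *v v) \<bullet> v"
    and tr: "\<And>t. s < t \<Longrightarrow> t \<le> T \<Longrightarrow> trace (a t) \<le> K"
    and \<Gamma>: "\<And>t. t0 < t \<Longrightarrow> (\<Gamma> has_vector_derivative a t) (at t)" and "\<Gamma> s = 0"
    and u: "\<And>x t. t0 < t \<Longrightarrow> 0 < u x t \<and> u x t \<le> C"
    and "t0 < s" "s < T" and \<epsilon>: "0 < \<epsilon>" "\<epsilon> < 1"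
  shows "(exp (\<epsilon> * \<mu> + \<epsilon>\<^sup>2 / 2 * ((\<Gamma> T *v \<theta>) \<bullet> \<theta>)) * u (x + \<epsilon> *\<^sub>R (\<Gamma> T *v \<theta>)) T - u x T) / \<epsilon> + u x T
     \<le> C * exp (\<mu> + 1 / 2 * ((\<Gamma> T *v \<theta>) \<bullet> \<theta>))"
proof -
  \<comment> \<open>The exponent is normalised to equal \<open>\<mu>\<close> at the point \<open>x\<close> of the estimate.\<close>
  define \<kappa> where "\<kappa> = \<mu> - \<theta> \<bullet> x"
  define y where "y x t = exp (\<theta> \<bullet> x + \<kappa> + 1 / 2 * ((\<Gamma> t *v \<theta>) \<bullet> \<theta>))" for x t
  define v where "v x t = exp ((\<epsilon> *\<^sub>R \<theta>) \<bullet> x + \<epsilon> * \<kappa> + 1 / 2 * ((\<Gamma> t *v (\<epsilon> *\<^sub>R \<theta>)) \<bullet> (\<epsilon> *\<^sub>R \<theta>)))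
      * u (x + \<Gamma> t *v (\<epsilon> *\<^sub>R \<theta>)) t" for x t
  define W where "W x t = C * (y x t * 1) + ((- 1 / \<epsilon>) * v x t + (1 / \<epsilon> - 1) * u x t)" for x t
  have "heat_solution a t0 (\<lambda>x t. y x t * 1)" unfolding y_def
    by (rule heat_solution_exp_shift[OF smooth_heat_solution_const order_refl sym \<Gamma>])
  moreover have "heat_solution a t0 v" unfolding v_def[abs_def]
    by (rule heat_solution_exp_shift[OF sol order_refl sym \<Gamma>])
  moreover have "heat_solution a t0 u" by (rule smooth_heat_solution_imp_heat_solution[OF sol order_refl])
  ultimately have W: "heat_solution a t0 W"
    unfolding W_def[abs_def] by (intro heat_solution_add heat_solution_cmult)
  have C: "0 < C" using u[of T x] \<open>t0 < s\<close> \<open>s < T\<close> by simp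
  \<comment> \<open>For \<open>\<epsilon> < 1\<close> the exponent of \<open>v\<close> is at most \<open>\<epsilon>\<close> times that of \<open>y\<close>, as \<open>\<Gamma>\<close> is positive semidefinite.  Hence
    \<open>v\<close> is dominated by \<open>y\<close>, which makes \<open>W\<close> bounded below although \<open>y\<close> and \<open>v\<close> are unbounded.\<close>
  have vexp: "v x t \<le> (1 + \<epsilon> * (y x t - 1)) * u (x + \<Gamma> t *v (\<epsilon> *\<^sub>R \<theta>)) t" if "s \<le> t" for x t
  proof -
    have N: "0 \<le> (\<Gamma> t *v \<theta>) \<bullet> \<theta>"
      by (rule psd_of_psd_derivative[of s \<Gamma> a]) (use \<Gamma> psd \<open>t0 < s\<close> \<open>\<Gamma> s = 0\<close> that in auto)
    have "\<epsilon> * \<epsilon> * ((\<Gamma> t *v \<theta>) \<bullet> \<theta>) \<le> \<epsilon> * ((\<Gamma> t *v \<theta>) \<bullet> \<theta>)"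
      using \<epsilon> N by (intro mult_right_mono) auto
    then have "(\<epsilon> *\<^sub>R \<theta>) \<bullet> x + \<epsilon> * \<kappa> + 1 / 2 * ((\<Gamma> t *v (\<epsilon> *\<^sub>R \<theta>)) \<bullet> (\<epsilon> *\<^sub>R \<theta>))
        \<le> \<epsilon> * (\<theta> \<bullet> x + \<kappa> + 1 / 2 * ((\<Gamma> t *v \<theta>) \<bullet> \<theta>))"
      by (simp add: matrix_vector_mult_scaleR algebra_simps)
    then have "exp ((\<epsilon> *\<^sub>R \<theta>) \<bullet> x + \<epsilon> * \<kappa> + 1 / 2 * ((\<Gamma> t *v (\<epsilon> *\<^sub>R \<theta>)) \<bullet> (\<epsilon> *\<^sub>R \<theta>)))
        \<le> 1 + \<epsilon> * (y x t - 1)"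
      unfolding y_def using exp_mult_le[of \<epsilon>] \<epsilon> by (meson exp_le_cancel_iff less_imp_le order_trans)
    then show ?thesis unfolding v_def
      by (intro mult_right_mono) (use u[of t] that \<open>t0 < s\<close> in \<open>auto intro: less_imp_le\<close>)
  qed
  have ypos: "0 < y x t" for x t by (simp add: y_def)
  have bd: "0 \<le> 1 + \<epsilon> * (y x t - 1)" for x t
    using mult_pos_pos[OF \<epsilon>(1) ypos[of x t]] \<epsilon>(2) unfolding right_diff_distrib by linarith
  have lower: "- (C * (1 / \<epsilon> - 1)) \<le> W x t" if "s \<le> t" for x t
  proof -
    have "v x t \<le> (1 + \<epsilon> * (y x t - 1)) * C"
      using vexp[OF that, of x] mult_left_mono[OF _ bd, of "u (x + \<Gamma> t *v (\<epsilon> *\<^sub>R \<theta>)) t" C x t]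
        u[of t] that \<open>t0 < s\<close> by (meson le_less_trans not_le order_trans)
    then have "v x t / \<epsilon> \<le> (1 + \<epsilon> * (y x t - 1)) * C / \<epsilon>"
      using \<epsilon> by (intro divide_right_mono) auto
    also have "\<dots> = C * y x t + C * (1 / \<epsilon> - 1)" using \<epsilon> by (simp add: field_simps)
    finally have "v x t / \<epsilon> \<le> C * y x t + C * (1 / \<epsilon> - 1)" .
    moreover have "0 \<le> (1 / \<epsilon> - 1) * u x t"
      using \<epsilon> u[of t x] that \<open>t0 < s\<close> by (intro mult_nonneg_nonneg) auto
    ultimately show ?thesis by (simp add: W_def)
  qed
  have start: "0 \<le> W z s" for z
  proof -
    have "v z s / \<epsilon> \<le> (1 + \<epsilon> * (y z s - 1)) * u z s / \<epsilon>"
      using vexp[of s z] \<epsilon> \<open>\<Gamma> s = 0\<close> by (intro divide_right_mono) auto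
    also have "\<dots> = (1 / \<epsilon> - 1) * u z s + y z s * u z s" using \<epsilon> by (simp add: field_simps)
    also have "\<dots> \<le> (1 / \<epsilon> - 1) * u z s + y z s * C"
      using u[of s z] ypos[of z s] \<open>t0 < s\<close> by simp
    finally show ?thesis by (simp add: W_def mult_ac)
  qed
  have "0 \<le> W x T"
  proof (rule heat_minimum_principle[of a s W T K "C * (1 / \<epsilon> - 1)"])
    show "heat_solution a s W" using heat_solution_later_start[OF W] \<open>t0 < s\<close> by simp
    fix z :: "real ^ 'n" and e :: real assume e: "e > 0"
    have op: "open ((UNIV :: (real ^ 'n) set) \<times> {t0<..})" by (intro open_Times) auto
    have "continuous_on (UNIV \<times> {t0<..}) (\<lambda>p. W (fst p) (snd p))"
      using W by (simp add: heat_solution_def split_beta)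
    then have "isCont (\<lambda>p. W (fst p) (snd p)) (z, s)"
      using continuous_on_eq_continuous_at[OF op] \<open>t0 < s\<close> by auto
    then have "((\<lambda>p. W (fst p) (snd p)) \<longlongrightarrow> W z s) (at (z, s) within UNIV \<times> {s<..})"
      unfolding isCont_def using tendsto_within_subset by force
    moreover have "- e < W z s" using start[of z] e by simp
    ultimately have "\<forall>\<^sub>F p in at (z, s) within UNIV \<times> {s<..}. - e < W (fst p) (snd p)"
      by (rule order_tendstoD(1))
    then show "\<forall>\<^sub>F p in at (z, s) within UNIV \<times> {s<..}. - e \<le> W (fst p) (snd p)"
      by (rule eventually_mono) simp
  qed (use sym psd tr lower \<open>t0 < s\<close> \<open>s < T\<close> in auto)
  then show ?thesis using \<epsilon>
    by (simp add: W_def y_def v_def \<kappa>_def algebra_simps matrix_vector_mult_scaleR power2_eq_square diff_divide_distrib)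
qed

text \<open>
  Letting \<open>\<epsilon> \<rightarrow> 0\<close> gives \<open>\<mu> u + \<langle>G, \<Gamma> \<theta>\<rangle> + u \<le> C exp (\<mu> + 1/2 \<langle>\<Gamma> \<theta>, \<theta>\<rangle>)\<close> for every \<open>\<mu>\<close>.  The best
  choice of \<open>\<mu>\<close> makes the right-hand side equal to \<open>u\<close>, and \<open>\<theta>\<close> is the logarithmic gradient, so that
  \<open>\<langle>G, \<Gamma> \<theta>\<rangle> = u \<langle>\<Gamma> \<theta>, \<theta>\<rangle>\<close>.
\<close>

lemma heat_gradient_estimate_from:
  fixes u :: "real ^ 'n \<Rightarrow> real \<Rightarrow> real"
  assumes sol: "smooth_heat_solution a t0 u G H"
    and sym: "\<And>t. t0 < t \<Longrightarrow> transpose (a t) = a t"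
    and psd: "\<And>t v. t0 < t \<Longrightarrow> 0 \<le> (a t *v v) \<bullet> v"
    and tr: "\<And>t. s < t \<Longrightarrow> t \<le> T \<Longrightarrow> trace (a t) \<le> K"
    and \<Gamma>: "\<And>t. t0 < t \<Longrightarrow> (\<Gamma> has_vector_derivative a t) (at t)" and "\<Gamma> s = 0"
    and u: "\<And>x t. t0 < t \<Longrightarrow> 0 < u x t \<and> u x t \<le> C"
    and "t0 < s" "s < T" and \<theta>: "\<theta> = (1 / u x T) *\<^sub>R G x T"
  shows "1 / 2 * ((\<Gamma> T *v \<theta>) \<bullet> \<theta>) \<le> ln (C / u x T)"
proof -
  define N where "N = (\<Gamma> T *v \<theta>) \<bullet> \<theta>"
  define \<mu> where "\<mu> = ln (u x T / C) - 1 / 2 * N"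
  have T: "t0 < T" using \<open>t0 < s\<close> \<open>s < T\<close> by simp
  note uT = u[OF T, of x]
  have C: "0 < C" using uT by simp
  define F where "F \<epsilon> = exp (\<epsilon> * \<mu> + \<epsilon>\<^sup>2 / 2 * N) * u (x + \<epsilon> *\<^sub>R (\<Gamma> T *v \<theta>)) T" for \<epsilon>
  have "((\<lambda>\<epsilon>. x + \<epsilon> *\<^sub>R (\<Gamma> T *v \<theta>)) has_derivative (\<lambda>h. h *\<^sub>R (\<Gamma> T *v \<theta>))) (at 0)"
    by (auto intro!: derivative_eq_intros)
  from has_derivative_compose[OF this smooth_heat_solutionD(1)[OF sol T]]
  have "((\<lambda>\<epsilon>. u (x + \<epsilon> *\<^sub>R (\<Gamma> T *v \<theta>)) T) has_real_derivative G x T \<bullet> (\<Gamma> T *v \<theta>)) (at 0)"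
    by (simp add: has_field_derivative_def mult_commute_abs)
  then have "(F has_real_derivative \<mu> * u x T + G x T \<bullet> (\<Gamma> T *v \<theta>)) (at 0)"
    unfolding F_def[abs_def] by (auto intro!: derivative_eq_intros)
  then have "((\<lambda>h. (F h - F 0) / h) \<longlongrightarrow> \<mu> * u x T + G x T \<bullet> (\<Gamma> T *v \<theta>)) (at 0)"
    by (simp add: DERIV_def)
  then have "((\<lambda>h. (F h - F 0) / h + u x T) \<longlongrightarrow> \<mu> * u x T + G x T \<bullet> (\<Gamma> T *v \<theta>) + u x T) (at_right 0)"
    by (intro tendsto_intros) (auto simp: filterlim_at_split)
  moreover have "\<forall>\<^sub>F h in at_right 0. (F h - F 0) / h + u x T \<le> C * exp (\<mu> + 1 / 2 * N)"
    using eventually_at_right_real[of 0 1, simplified]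
  proof (eventually_elim)
    case (elim h)
    then show ?case
      using heat_difference_quotient_bound[OF sol sym psd tr \<Gamma> \<open>\<Gamma> s = 0\<close> u \<open>t0 < s\<close> \<open>s < T\<close>, of h \<mu> \<theta> x]
      by (simp add: F_def N_def)
  qed
  ultimately have "\<mu> * u x T + G x T \<bullet> (\<Gamma> T *v \<theta>) + u x T \<le> C * exp (\<mu> + 1 / 2 * N)"
    by (intro tendsto_upperbound) auto
  also have "\<dots> = u x T" using uT C by (simp add: \<mu>_def)
  also have "G x T = u x T *\<^sub>R \<theta>" using uT \<theta> by simp
  finally have "u x T * (\<mu> + N) \<le> 0" by (simp add: N_def algebra_simps inner_commute)
  then have "\<mu> + N \<le> 0" using uT by (simp add: mult_le_0_iff)
  then show ?thesis using uT C by (simp add: \<mu>_def N_def[symmetric] ln_div)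
qed

text \<open>
  The estimate started at time \<open>s\<close> involves \<open>\<Gamma> T - \<Gamma> s\<close>; let \<open>s\<close> tend to \<open>0\<close>.
\<close>

lemma heat_gradient_estimate:
  fixes u :: "real ^ 'n \<Rightarrow> real \<Rightarrow> real"
  assumes sol: "smooth_heat_solution a 0 u G H"
    and sym: "\<And>t. 0 < t \<Longrightarrow> transpose (a t) = a t"
    and psd: "\<And>t v. 0 < t \<Longrightarrow> 0 \<le> (a t *v v) \<bullet> v"
    and tr: "\<And>t. 0 < t \<Longrightarrow> t \<le> T \<Longrightarrow> trace (a t) \<le> K"
    and \<Gamma>: "\<And>t. 0 < t \<Longrightarrow> (\<Gamma> has_vector_derivative a t) (at t)" and \<Gamma>0: "(\<Gamma> \<longlongrightarrow> 0) (at_right 0)"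
    and u: "\<And>x t. 0 < t \<Longrightarrow> 0 < u x t \<and> u x t \<le> C"
    and "0 < T" and \<theta>: "\<theta> = (1 / u x T) *\<^sub>R G x T"
  shows "1 / 2 * ((\<Gamma> T *v \<theta>) \<bullet> \<theta>) \<le> ln (C / u x T)"
proof (rule tendsto_upperbound)
  show "((\<lambda>s. 1 / 2 * (((\<Gamma> T - \<Gamma> s) *v \<theta>) \<bullet> \<theta>)) \<longlongrightarrow> 1 / 2 * ((\<Gamma> T *v \<theta>) \<bullet> \<theta>)) (at_right 0)"
  proof -
    have "((\<lambda>s. (\<Gamma> T - \<Gamma> s) *v \<theta>) \<longlongrightarrow> (\<Gamma> T - 0) *v \<theta>) (at_right 0)"
      by (rule bounded_linear.tendsto[OF bounded_bilinear.bounded_linear_left[OF bounded_bilinear_matrix_vector_mult]])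
        (intro tendsto_intros \<Gamma>0)
    then show ?thesis by (intro tendsto_intros) simp
  qed
  show "\<forall>\<^sub>F s in at_right 0. 1 / 2 * (((\<Gamma> T - \<Gamma> s) *v \<theta>) \<bullet> \<theta>) \<le> ln (C / u x T)"
    using eventually_at_right_real[OF \<open>0 < T\<close>]
  proof eventually_elim
    case (elim s)
    show ?case
    proof (rule heat_gradient_estimate_from[OF sol sym psd, where \<Gamma> = "\<lambda>t. \<Gamma> t - \<Gamma> s"])
      show "((\<lambda>t. \<Gamma> t - \<Gamma> s) has_vector_derivative a t) (at t)" if "0 < t" for t
        using has_vector_derivative_diff[OF \<Gamma>[OF that] has_vector_derivative_const] by simp
      show "trace (a t) \<le> K" if "s < t" "t \<le> T" for t using that elim tr by simp
    qed (use elim u \<theta> in auto)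
  qed
qed simp

section \<open>Averages of solutions over translates\<close>

lemma bounded_linear_trace: "bounded_linear (trace :: real ^ 'n ^ 'n \<Rightarrow> real)"
  unfolding linear_conv_bounded_linear[symmetric]
  by (auto intro!: linearI simp: trace_def sum.distrib sum_distrib_left)

lemma bounded_linear_Blinfun_matrix:
  "bounded_linear (\<lambda>M :: real ^ 'n ^ 'm. Blinfun ((*v) M))"
  unfolding linear_conv_bounded_linear[symmetric]
  by (auto intro!: linearI blinfun_eqI
      simp: bounded_linear_Blinfun_apply blinfun.add_left blinfun.scaleR_left
        matrix_vector_mult_add_rdistrib scaleR_matrix_vector_assoc)

text \<open>
  The coefficients do not depend on \<open>x\<close>, so translates of a solution are solutions, and averages of
  translates are solutions by differentiation under the integral.
\<close>

lemma heat_solution_average: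
  fixes w :: "real ^ 'n \<Rightarrow> real \<Rightarrow> real"
  assumes sol: "smooth_heat_solution a t0 w G H"
    and a: "continuous_on {t0<..} a" and \<phi>: "continuous_on (cbox p q) \<phi>"
  shows "heat_solution a t0 (\<lambda>x t. integral (cbox p q) (\<lambda>y. \<phi> y * w (x + y) t))"
proof -
  note cont = smooth_heat_solution_continuous[OF sol]
  have c\<phi>: "continuous_on S (\<lambda>z. \<phi> (g z))" if "continuous_on S g" "g ` S \<subseteq> cbox p q" for S and g :: "'z::topological_space \<Rightarrow> _"
    using continuous_on_compose2[OF \<phi>] that by blast
  have cw: "continuous_on S (\<lambda>z. w (g z) (h z))" if "continuous_on S g" "continuous_on S h" "h ` S \<subseteq> {t0<..}"
    for S and g :: "'z::topological_space \<Rightarrow> _" and h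
    using continuous_on_compose2[OF cont(1), of S "\<lambda>z. (g z, h z)"] that by (force intro!: continuous_intros)
  have cG: "continuous_on S (\<lambda>z. G (g z) (h z))" if "continuous_on S g" "continuous_on S h" "h ` S \<subseteq> {t0<..}"
    for S and g :: "'z::topological_space \<Rightarrow> _" and h
    using continuous_on_compose2[OF cont(2), of S "\<lambda>z. (g z, h z)"] that by (force intro!: continuous_intros)
  have cH: "continuous_on S (\<lambda>z. H (g z) (h z))" if "continuous_on S g" "continuous_on S h" "h ` S \<subseteq> {t0<..}"
    for S and g :: "'z::topological_space \<Rightarrow> _" and h
    using continuous_on_compose2[OF cont(3), of S "\<lambda>z. (g z, h z)"] that by (force intro!: continuous_intros)
  have ca: "continuous_on S (\<lambda>z. a (h z))" if "continuous_on S h" "h ` S \<subseteq> {t0<..}"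
    for S and h :: "'z::topological_space \<Rightarrow> _"
    using continuous_on_compose2[OF a that(1)] that by blast
  show ?thesis unfolding heat_solution_def
  proof (intro conjI allI impI)
    have "continuous_on ((UNIV \<times> {t0<..}) \<times> cbox p q) (\<lambda>(z, y). \<phi> y * w (fst z + y) (snd z))"
      unfolding split_beta by (intro continuous_intros c\<phi> cw) auto
    from integral_continuous_on_param[OF this]
    show "continuous_on (UNIV \<times> {t0<..}) (\<lambda>(x, t). integral (cbox p q) (\<lambda>y. \<phi> y * w (x + y) t))"
      by (simp add: split_beta)
  next
    fix t assume t: "t0 < t"
    define g where "g x = integral (cbox p q) (\<lambda>y. \<phi> y *\<^sub>R G (x + y) t)" for x
    have line: "((\<lambda>x. x + y) has_derivative (\<lambda>h. h)) (at x)" for x y :: "real ^ 'n"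
      by (auto intro!: derivative_eq_intros)
    have int_w: "(\<lambda>y. \<phi> y * w (x + y) t) integrable_on cbox p q" for x
      by (intro integrable_continuous continuous_intros c\<phi> cw) (use t in auto)
    have int_G: "(\<lambda>y. \<phi> y *\<^sub>R G (x + y) t) integrable_on cbox p q" for x
      by (intro integrable_continuous continuous_intros c\<phi> cG) (use t in auto)
    have int_H: "(\<lambda>y. \<phi> y *\<^sub>R H (x + y) t) integrable_on cbox p q" for x
      by (intro integrable_continuous continuous_intros c\<phi> cH) (use t in auto)
    show "\<exists>g. (\<forall>x. ((\<lambda>x. integral (cbox p q) (\<lambda>y. \<phi> y * w (x + y) t)) has_derivative (\<lambda>h. g x \<bullet> h)) (at x)) \<and>
        (\<forall>x. \<exists>K. (g has_derivative K) (at x) \<and>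
          ((\<lambda>t. integral (cbox p q) (\<lambda>y. \<phi> y * w (x + y) t)) has_real_derivative 1 / 2 * hess_trace (a t) K) (at t))"
    proof (rule exI[of _ g], intro conjI allI)
      fix x
      have "((\<lambda>x. integral (cbox p q) (\<lambda>y. \<phi> y * w (x + y) t)) has_derivative
          blinfun_apply (integral (cbox p q) (\<lambda>y. blinfun_inner_right (\<phi> y *\<^sub>R G (x + y) t)))) (at x within UNIV)"
      proof (rule leibniz_rule[where fx = "\<lambda>x y. blinfun_inner_right (\<phi> y *\<^sub>R G (x + y) t)"])
        show "((\<lambda>x. \<phi> y * w (x + y) t) has_derivative blinfun_apply (blinfun_inner_right (\<phi> y *\<^sub>R G (x + y) t))) (at x)" for x y
        proof -
          have "((\<lambda>x. w (x + y) t) has_derivative (\<lambda>h. G (x + y) t \<bullet> h)) (at x)"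
            using has_derivative_compose[OF line smooth_heat_solutionD(1)[OF sol t]] by simp
          from has_derivative_mult_right[OF this, of "\<phi> y"] show ?thesis
            by (rule has_derivative_eq_rhs) (simp add: fun_eq_iff)
        qed
        have "continuous_on (UNIV \<times> cbox p q) (\<lambda>z. \<phi> (snd z) *\<^sub>R G (fst z + snd z) t)"
          by (intro continuous_intros c\<phi> cG) (use t in auto)
        from bounded_linear.continuous_on[OF bounded_linear_blinfun_inner_right this]
        show "continuous_on (UNIV \<times> cbox p q) (\<lambda>(x, y). blinfun_inner_right (\<phi> y *\<^sub>R G (x + y) t))"
          by (simp add: split_beta)
      qed (use int_w in auto)
      also have "integral (cbox p q) (\<lambda>y. blinfun_inner_right (\<phi> y *\<^sub>R G (x + y) t)) = blinfun_inner_right (g x)"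
        using integral_linear[OF int_G bounded_linear_blinfun_inner_right, of x] by (simp add: g_def o_def)
      finally show "((\<lambda>x. integral (cbox p q) (\<lambda>y. \<phi> y * w (x + y) t)) has_derivative (\<lambda>h. g x \<bullet> h)) (at x)"
        by simp
      define K where "K = integral (cbox p q) (\<lambda>y. \<phi> y *\<^sub>R H (x + y) t)"
      have "(g has_derivative
          blinfun_apply (integral (cbox p q) (\<lambda>y. Blinfun ((*v) (\<phi> y *\<^sub>R H (x + y) t))))) (at x within UNIV)"
        unfolding g_def
      proof (rule leibniz_rule[where fx = "\<lambda>x y. Blinfun ((*v) (\<phi> y *\<^sub>R H (x + y) t))"])
        show "((\<lambda>x. \<phi> y *\<^sub>R G (x + y) t) has_derivative blinfun_apply (Blinfun ((*v) (\<phi> y *\<^sub>R H (x + y) t)))) (at x)" for x y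
          using has_derivative_scaleR_right[OF has_derivative_compose[OF line smooth_heat_solutionD(2)[OF sol t]], of "\<phi> y"]
          by (simp add: bounded_linear_Blinfun_apply scaleR_matrix_vector_assoc)
        have "continuous_on (UNIV \<times> cbox p q) (\<lambda>z. \<phi> (snd z) *\<^sub>R H (fst z + snd z) t)"
          by (intro continuous_intros c\<phi> cH) (use t in auto)
        from bounded_linear.continuous_on[OF bounded_linear_Blinfun_matrix this]
        show "continuous_on (UNIV \<times> cbox p q) (\<lambda>(x, y). Blinfun ((*v) (\<phi> y *\<^sub>R H (x + y) t)))"
          by (simp add: split_beta)
      qed (use int_G in auto)
      also have "integral (cbox p q) (\<lambda>y. Blinfun ((*v) (\<phi> y *\<^sub>R H (x + y) t))) = Blinfun ((*v) K)"
        using integral_linear[OF int_H bounded_linear_Blinfun_matrix, of x] by (simp add: K_def o_def)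
      finally have dK: "(g has_derivative (*v) K) (at x)" by (simp add: bounded_linear_Blinfun_apply)
      have "((\<lambda>t. integral (cbox p q) (\<lambda>y. \<phi> y * w (x + y) t)) has_real_derivative
         integral (cbox p q) (\<lambda>y. \<phi> y * (1 / 2 * trace (a t ** H (x + y) t)))) (at t within {t0<..})"
      proof (rule leibniz_rule_field_derivative[where fx = "\<lambda>t y. \<phi> y * (1 / 2 * trace (a t ** H (x + y) t))"])
        show "((\<lambda>t. \<phi> y * w (x + y) t) has_real_derivative \<phi> y * (1 / 2 * trace (a t ** H (x + y) t))) (at t within {t0<..})"
          if "t \<in> {t0<..}" for t y
          by (rule DERIV_cmult) (use smooth_heat_solutionD(3)[OF sol] that in \<open>simp add: has_field_derivative_at_within\<close>)
        show "(\<lambda>y. \<phi> y * w (x + y) t) integrable_on cbox p q" if "t \<in> {t0<..}" for t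
          by (intro integrable_continuous continuous_intros c\<phi> cw) (use that in auto)
        have "continuous_on ({t0<..} \<times> cbox p q) (\<lambda>z. a (fst z) ** H (x + snd z) (fst z))"
          by (intro continuous_intros ca cH) auto
        from bounded_linear.continuous_on[OF bounded_linear_trace this]
        show "continuous_on ({t0<..} \<times> cbox p q) (\<lambda>(t, y). \<phi> y * (1 / 2 * trace (a t ** H (x + y) t)))"
          unfolding split_beta by (intro continuous_intros c\<phi>) auto
      qed (use t in auto)
      also have "integral (cbox p q) (\<lambda>y. \<phi> y * (1 / 2 * trace (a t ** H (x + y) t))) = 1 / 2 * hess_trace (a t) ((*v) K)"
      proof -
        have "bounded_linear (\<lambda>M. 1 / 2 * trace (a t ** M))"
          by (rule bounded_linear_compose[OF bounded_linear_mult_right bounded_linear_compose[OF bounded_linear_trace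
            bounded_bilinear.bounded_linear_right[OF bounded_bilinear_matrix_mult]]])
        from integral_linear[OF int_H this, of x] show ?thesis
          by (simp add: K_def o_def hess_trace_matrix bounded_bilinear.scaleR_right[OF bounded_bilinear_matrix_mult]
              linear_cmul[OF bounded_linear.linear[OF bounded_linear_trace]] mult_ac)
      qed
      finally have "((\<lambda>t. integral (cbox p q) (\<lambda>y. \<phi> y * w (x + y) t)) has_real_derivative 1 / 2 * hess_trace (a t) ((*v) K)) (at t)"
        using at_within_open[of t "{t0<..}"] t by simp
      with dK show "\<exists>K. (g has_derivative K) (at x) \<and>
          ((\<lambda>t. integral (cbox p q) (\<lambda>y. \<phi> y * w (x + y) t)) has_real_derivative 1 / 2 * hess_trace (a t) K) (at t)"
        by blast
    qed
  qed
qed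

section \<open>Linear changes of variables for Lebesgue measure\<close>

lemma nn_integral_lborel_translate:
  fixes f :: "'a::euclidean_space \<Rightarrow> ennreal"
  assumes [measurable]: "f \<in> borel_measurable borel"
  shows "(\<integral>\<^sup>+x. f (x + c) \<partial>lborel) = (\<integral>\<^sup>+x. f x \<partial>lborel)"
proof -
  have "(\<integral>\<^sup>+x. f x \<partial>lborel) = (\<integral>\<^sup>+x. f x \<partial>distr lborel borel ((+) c))"
    by (simp add: lborel_distr_plus)
  also have "\<dots> = (\<integral>\<^sup>+x. f (c + x) \<partial>lborel)" by (rule nn_integral_distr) auto
  finally show ?thesis by (simp add: add.commute)
qed

lemma integral_lborel_translate:
  fixes f :: "'a::euclidean_space \<Rightarrow> real"
  assumes [measurable]: "f \<in> borel_measurable borel"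
  shows "(LINT x|lborel. f (x + c)) = (LINT x|lborel. f x)"
proof -
  have "(LINT x|lborel. f x) = (LINT x|distr lborel borel ((+) c). f x)"
    by (simp add: lborel_distr_plus)
  also have "\<dots> = (LINT x|lborel. f (c + x))" by (rule integral_distr) auto
  finally show ?thesis by (simp add: add.commute)
qed

text \<open>
  A linear bijection scales Lebesgue measure by a constant: the image measure is invariant
  under translations, and such a measure is compared with Lebesgue measure by Fubini's theorem applied to
  \<open>h y * g (L x + y)\<close>, where \<open>h\<close> is the indicator of the unit ball.
\<close>

lemma nn_integral_lborel_linear:
  fixes L M :: "'a::euclidean_space \<Rightarrow> 'a" and g :: "'a \<Rightarrow> ennreal"
  assumes L: "linear L" and inv: "\<And>y. L (M y) = y"
    and [measurable]: "g \<in> borel_measurable borel"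
  shows "emeasure lborel (ball (0 :: 'a) 1) * (\<integral>\<^sup>+x. g (L x) \<partial>lborel) =
    emeasure lborel (L -` ball 0 1) * (\<integral>\<^sup>+x. g x \<partial>lborel)"
proof -
  have [measurable]: "L \<in> borel_measurable borel"
    using L by (intro borel_measurable_continuous_onI linear_continuous_on) (simp add: linear_conv_bounded_linear)
  define h :: "'a \<Rightarrow> ennreal" where "h = indicator (ball 0 1)"
  have [measurable]: "h \<in> borel_measurable borel" unfolding h_def by (rule borel_measurable_indicator) simp
  have hB: "(\<integral>\<^sup>+y. h y \<partial>lborel) = emeasure lborel (ball (0 :: 'a) 1)"
    unfolding h_def by (rule nn_integral_indicator) simp
  have h_even: "h (- y) = h y" for y by (simp add: h_def indicator_def)
  have "emeasure lborel (ball (0 :: 'a) 1) * (\<integral>\<^sup>+x. g (L x) \<partial>lborel)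
      = (\<integral>\<^sup>+y. h y * (\<integral>\<^sup>+x. g (L x) \<partial>lborel) \<partial>lborel)"
    by (simp add: nn_integral_multc hB)
  also have "\<dots> = (\<integral>\<^sup>+y. \<integral>\<^sup>+x. h y * g (L x + y) \<partial>lborel \<partial>lborel)"
  proof (intro nn_integral_cong)
    fix y
    have "(\<integral>\<^sup>+x. g (L x) \<partial>lborel) = (\<integral>\<^sup>+x. g (L (x + M y)) \<partial>lborel)"
      by (rule nn_integral_lborel_translate[symmetric]) measurable
    then show "h y * (\<integral>\<^sup>+x. g (L x) \<partial>lborel) = (\<integral>\<^sup>+x. h y * g (L x + y) \<partial>lborel)"
      by (simp add: nn_integral_cmult linear_add[OF L] inv)
  qed
  also have "\<dots> = (\<integral>\<^sup>+x. \<integral>\<^sup>+y. h y * g (L x + y) \<partial>lborel \<partial>lborel)"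
    by (rule lborel_pair.Fubini') measurable
  also have "\<dots> = (\<integral>\<^sup>+x. \<integral>\<^sup>+y. h (y - L x) * g y \<partial>lborel \<partial>lborel)"
  proof (rule nn_integral_cong)
    fix x
    show "(\<integral>\<^sup>+y. h y * g (L x + y) \<partial>lborel) = (\<integral>\<^sup>+y. h (y - L x) * g y \<partial>lborel)"
      using nn_integral_lborel_translate[of "\<lambda>y. h (y - L x) * g y" "L x"] by (simp add: add.commute)
  qed
  also have "\<dots> = (\<integral>\<^sup>+y. \<integral>\<^sup>+x. h (y - L x) * g y \<partial>lborel \<partial>lborel)"
    by (rule lborel_pair.Fubini') measurable
  also have "\<dots> = (\<integral>\<^sup>+y. (\<integral>\<^sup>+x. h (L x) \<partial>lborel) * g y \<partial>lborel)"
  proof (intro nn_integral_cong)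
    fix y
    have "(\<integral>\<^sup>+x. h (L x) \<partial>lborel) = (\<integral>\<^sup>+x. h (L (x + - M y)) \<partial>lborel)"
      by (rule nn_integral_lborel_translate[symmetric]) measurable
    also have "\<dots> = (\<integral>\<^sup>+x. h (y - L x) \<partial>lborel)"
      using h_even[of "y - L _"] by (simp add: linear_diff[OF L] inv)
    finally show "(\<integral>\<^sup>+x. h (y - L x) * g y \<partial>lborel) = (\<integral>\<^sup>+x. h (L x) \<partial>lborel) * g y"
      by (simp add: nn_integral_multc)
  qed
  also have "(\<integral>\<^sup>+x. h (L x) \<partial>lborel) = (\<integral>\<^sup>+x. indicator (L -` ball 0 1) x \<partial>lborel)"
    by (intro nn_integral_cong) (simp add: h_def indicator_def)
  also have "\<dots> = emeasure lborel (L -` ball 0 1)"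
    by (rule nn_integral_indicator) (use measurable_sets[of L borel borel "ball 0 1"] in simp)
  finally show ?thesis by (simp add: nn_integral_cmult)
qed

text \<open>
  Of the scaling constant only an upper bound in terms of the norm of the inverse map is needed
  later; it must be uniform when the linear map varies in a compact set.
\<close>

lemma integral_lborel_linear:
  fixes L M :: "'a::euclidean_space \<Rightarrow> 'a"
  assumes L: "linear L" and inv: "\<And>y. L (M y) = y" "\<And>x. M (L x) = x" and K: "\<And>y. norm (M y) \<le> K * norm y" "0 < K"
  obtains c where "0 \<le> c" "c \<le> measure lborel (ball (0 :: 'a) K) / measure lborel (ball (0 :: 'a) 1)"
    "\<And>f :: 'a \<Rightarrow> real. f \<in> borel_measurable borel \<Longrightarrow> (LINT x|lborel. f (L x)) = c * (LINT x|lborel. f x)"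
proof -
  have [measurable]: "L \<in> borel_measurable borel"
    using L by (intro borel_measurable_continuous_onI linear_continuous_on) (simp add: linear_conv_bounded_linear)
  let ?B = "ball (0 :: 'a) 1"
  have sub: "L -` ?B \<subseteq> ball 0 K"
  proof
    fix x assume "x \<in> L -` ?B"
    then have "norm (L x) < 1" by simp
    have "norm x \<le> K * norm (L x)" using K(1)[of "L x"] inv by simp
    also have "\<dots> < K * 1" using \<open>norm (L x) < 1\<close> K(2) by (intro mult_strict_left_mono) auto
    finally show "x \<in> ball 0 K" by simp
  qed
  have sets: "L -` ?B \<in> sets lborel" using measurable_sets[of L borel borel "ball 0 1"] by simp
  have fin: "emeasure lborel (ball (0 :: 'a) r) < \<infinity>" for r
    using emeasure_bounded_finite[of "ball (0 :: 'a) r"] by simp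
  have "emeasure lborel (L -` ?B) \<le> emeasure lborel (ball (0 :: 'a) K)"
    using sub by (intro emeasure_mono) auto
  then have finL: "emeasure lborel (L -` ?B) < \<infinity>" using fin le_less_trans by blast
  have pos: "0 < measure lborel ?B"
    using content_ball_pos[of 1 "0 :: 'a"] by simp
  define c where "c = measure lborel (L -` ?B) / measure lborel ?B"
  have c0: "0 \<le> c" by (simp add: c_def)
  have "distr lborel borel L = density lborel (\<lambda>_. ennreal c)"
  proof (rule measure_eqI)
    fix X assume "X \<in> sets (distr lborel borel L)"
    then have [measurable]: "X \<in> sets borel" by simp
    have "emeasure lborel ?B * emeasure (distr lborel borel L) X =
        emeasure lborel ?B * (\<integral>\<^sup>+x. indicator X (L x) \<partial>lborel)"
      by (subst nn_integral_indicator[symmetric], simp, subst nn_integral_distr) simp_all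
    also have "\<dots> = emeasure lborel (L -` ?B) * (\<integral>\<^sup>+x. indicator X x \<partial>lborel)"
      by (rule nn_integral_lborel_linear[OF L inv(1)]) simp
    also have "\<dots> = emeasure lborel (L -` ?B) * emeasure lborel X" by simp
    also have "emeasure lborel (L -` ?B) = emeasure lborel ?B * ennreal c"
      using fin[of 1] finL pos
      by (simp add: emeasure_eq_ennreal_measure less_top c_def flip: ennreal_mult)
    finally have "emeasure lborel ?B * emeasure (distr lborel borel L) X = emeasure lborel ?B * (ennreal c * emeasure lborel X)"
      by (simp add: mult.assoc)
    moreover have "emeasure lborel ?B \<noteq> 0" "emeasure lborel ?B \<noteq> \<infinity>"
      using pos fin[of 1] by (auto simp: measure_def)
    ultimately have "emeasure (distr lborel borel L) X = ennreal c * emeasure lborel X"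
      by (auto simp: ennreal_mult_cancel_left infinity_ennreal_def)
    also have "\<dots> = emeasure (density lborel (\<lambda>_. ennreal c)) X"
      by (simp add: emeasure_density nn_integral_cmult)
    finally show "emeasure (distr lborel borel L) X = emeasure (density lborel (\<lambda>_. ennreal c)) X" .
  qed simp
  show ?thesis
  proof (rule that[OF c0])
    show "c \<le> measure lborel (ball (0 :: 'a) K) / measure lborel ?B"
      unfolding c_def using sub sets fin[of K] pos
      by (intro divide_right_mono measure_mono_fmeasurable) (auto simp: fmeasurable_def)
    fix f :: "'a \<Rightarrow> real" assume [measurable]: "f \<in> borel_measurable borel"
    have "(LINT x|lborel. f (L x)) = (LINT x|distr lborel borel L. f x)"
      by (rule integral_distr[symmetric]) auto
    also have "\<dots> = (LINT x|density lborel (\<lambda>_. ennreal c). f x)" by (simp add: \<open>distr lborel borel L = _\<close>)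
    also have "\<dots> = (LINT x|lborel. c *\<^sub>R f x)" by (rule integral_density) (use c0 in auto)
    finally show "(LINT x|lborel. f (L x)) = c * (LINT x|lborel. f x)" by simp
  qed
qed

lemma integral_lborel_supported:
  fixes F :: "'a::euclidean_space \<Rightarrow> real"
  assumes "continuous_on UNIV F" "\<And>x. x \<notin> cbox p q \<Longrightarrow> F x = 0"
  shows "integrable lborel F" "(LINT x|lborel. F x) = integral (cbox p q) F"
proof -
  have eq: "indicator (cbox p q) x * F x = F x" for x using assms(2)[of x] by (cases "x \<in> cbox p q") auto
  have "continuous_on (cbox p q) F" using assms(1) continuous_on_subset by blast
  from borel_integrable_compact[OF compact_cbox this]
  have *: "set_integrable lborel (cbox p q) F" by (simp add: set_integrable_def)
  then show "integrable lborel F" by (simp add: set_integrable_def eq)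
  show "(LINT x|lborel. F x) = integral (cbox p q) F"
    using set_borel_integral_eq_integral(2)[OF *] by (simp add: set_lebesgue_integral_def eq)
qed

lemma cball_subset_One_cbox: "cball 0 R \<subseteq> cbox (- R *\<^sub>R One) (R *\<^sub>R One :: 'a::euclidean_space)"
proof
  fix x :: 'a assume "x \<in> cball 0 R"
  then have "\<bar>x \<bullet> b\<bar> \<le> R" if "b \<in> Basis" for b using Basis_le_norm[OF that, of x] by simp
  then show "x \<in> cbox (- R *\<^sub>R One) (R *\<^sub>R One :: 'a::euclidean_space)" by (force simp: mem_box abs_le_iff)
qed

section \<open>The bound of the initial value persists\<close>

text \<open>
  Moves the average from the coordinates in which the equation has no drift to those in which the
  initial value is prescribed.
\<close>

lemma average_change_of_variables:
  fixes P Q :: "real ^ 'n ^ 'n" and g \<phi> :: "real ^ 'n \<Rightarrow> real"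
  assumes inv: "P ** Q = Finite_Cartesian_Product.mat 1" "Q ** P = Finite_Cartesian_Product.mat 1"
    and K: "\<And>y. norm (Q *v y) \<le> K * norm y" "0 < K"
    and g: "continuous_on UNIV g" and \<phi>: "continuous_on UNIV \<phi>"
    and supp: "\<And>y. y \<notin> cbox p q \<Longrightarrow> \<phi> y = 0"
    and supp': "\<And>w. w \<notin> cbox p' q' \<Longrightarrow> \<phi> (Q *v w - x) = 0"
  obtains c where "0 \<le> c" "c \<le> measure lborel (ball (0 :: real ^ 'n) K) / measure lborel (ball (0 :: real ^ 'n) 1)"
    "integral (cbox p q) (\<lambda>y. \<phi> y * g (P *v (x + y))) = c * integral (cbox p' q') (\<lambda>w. \<phi> (Q *v w - x) * g w)"
proof -
  have PQ: "P *v (Q *v y) = y" "Q *v (P *v y) = y" for y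
    using inv by (simp_all add: matrix_vector_mul_assoc)
  define F where "F w = \<phi> (Q *v w - x) * g w" for w
  have comp: "continuous_on UNIV (\<lambda>y. h (k y))" if "continuous_on UNIV h" "continuous_on UNIV k"
    for h :: "real ^ 'n \<Rightarrow> real" and k :: "real ^ 'n \<Rightarrow> real ^ 'n"
    using continuous_on_compose2[OF that(1,2)] by simp
  have F: "continuous_on UNIV F" unfolding F_def[abs_def]
    by (intro continuous_intros comp[OF g] comp[OF \<phi>])
  have cF: "continuous_on UNIV (\<lambda>y. \<phi> y * g (P *v (x + y)))"
    by (intro continuous_intros comp[OF g] comp[OF \<phi>])
  obtain c where c: "0 \<le> c" "c \<le> measure lborel (ball (0 :: real ^ 'n) K) / measure lborel (ball (0 :: real ^ 'n) 1)"
    "\<And>f :: real ^ 'n \<Rightarrow> real. f \<in> borel_measurable borel \<Longrightarrow> (LINT x|lborel. f (P *v x)) = c * (LINT x|lborel. f x)"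
    using integral_lborel_linear[OF matrix_vector_mul_linear PQ K] by metis
  have "integral (cbox p q) (\<lambda>y. \<phi> y * g (P *v (x + y))) = (LINT y|lborel. \<phi> y * g (P *v (x + y)))"
    by (rule integral_lborel_supported(2)[OF cF, symmetric]) (simp add: supp)
  also have "\<dots> = (LINT y|lborel. F (P *v (y + x)))"
    by (simp add: F_def PQ add.commute matrix_vector_right_distrib)
  also have "\<dots> = (LINT y|lborel. F (P *v y))"
    by (rule integral_lborel_translate) (intro borel_measurable_continuous_onI comp[OF F] continuous_intros)
  also have "\<dots> = c * (LINT w|lborel. F w)"
    by (rule c(3)) (rule borel_measurable_continuous_onI[OF F])
  also have "(LINT w|lborel. F w) = integral (cbox p' q') F"
    by (rule integral_lborel_supported(2)[OF F]) (simp add: F_def supp')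
  finally show ?thesis using that c(1,2) by (simp add: F_def[abs_def])
qed

text \<open>
  The initial value is attained only when it is tested against a fixed function.  The weights
  \<open>\<lambda>w. \<phi> (Q t *v w - x)\<close> vary with \<open>(x, t)\<close>, but for \<open>(x, t)\<close> near \<open>(z, 0)\<close> they live in a common box and
  converge in \<open>L\<^sup>1\<close> to \<open>\<lambda>w. \<phi> (Q 0 *v w - z)\<close>.  Since \<open>C - u\<close> is bounded, the integral against the varying
  weights has the same limit as the one against the fixed weight, which is nonnegative because \<open>f \<le> C\<close>.
\<close>

lemma smoothed_initial_value_bound:
  fixes u :: "real ^ 'n \<Rightarrow> real \<Rightarrow> real" and Q :: "real \<Rightarrow> real ^ 'n ^ 'n"
  assumes iv: "has_initial_value u f" and f: "\<And>y. f y \<le> C" "0 \<le> C"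
    and ub: "\<And>x t. 0 < t \<Longrightarrow> \<bar>C - u x t\<bar> \<le> L"
    and cont: "\<And>t. 0 < t \<Longrightarrow> continuous_on UNIV (\<lambda>w. u w t)"
    and Q: "continuous_on UNIV Q"
    and K: "\<And>t y. 0 \<le> t \<Longrightarrow> t \<le> T \<Longrightarrow> norm y \<le> K * norm (Q t *v y)" "0 < K" "0 < T"
    and \<phi>: "continuous_on UNIV \<phi>" "\<And>y. 0 \<le> \<phi> y" "\<And>y. d \<le> norm y \<Longrightarrow> \<phi> y = 0" and "0 < e"
  obtains p q where "\<forall>\<^sub>F xt in at (z, 0) within UNIV \<times> {0<..}.
    (\<forall>w. w \<notin> cbox p q \<longrightarrow> \<phi> (Q (snd xt) *v w - fst xt) = 0) \<and>
    - e \<le> integral (cbox p q) (\<lambda>w. \<phi> (Q (snd xt) *v w - fst xt) * (C - u w (snd xt)))"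
proof -
  \<comment> \<open>Outside the ball of radius \<open>R\<close>, \<open>Q t *v w - x\<close> has norm at least \<open>d\<close> for all \<open>x\<close> within distance \<open>1\<close> of \<open>z\<close>.\<close>
  define R where "R = K * (norm z + 1 + \<bar>d\<bar>)"
  define p q :: "real ^ 'n" where "p = - R *\<^sub>R One" and "q = R *\<^sub>R One"
  define S where "S = cbox p q"
  have supp: "\<phi> (Q t *v w - x) = 0" if "w \<notin> S" "dist x z \<le> 1" "0 \<le> t" "t \<le> T" for x t w
  proof -
    have "R < norm w" using that(1) cball_subset_One_cbox[of R] by (force simp: S_def p_def q_def)
    also have "\<dots> \<le> K * norm (Q t *v w)" using K that by blast
    finally have "norm z + 1 + \<bar>d\<bar> < norm (Q t *v w)" using K(2) by (simp add: R_def)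
    moreover have "norm (Q t *v w) \<le> norm x + norm (Q t *v w - x)" by (rule norm_triangle_sub)
    moreover have "norm x \<le> norm z + 1" using that(2) norm_triangle_sub[of x z] by (simp add: dist_norm)
    ultimately show ?thesis by (intro \<phi>(3)) simp
  qed
  have comp: "continuous_on X (\<lambda>y. \<phi> (k y))" if "continuous_on X k" for k :: "'z::topological_space \<Rightarrow> _" and X
    using continuous_on_compose2[OF \<phi>(1) that] by simp
  have cQ: "continuous_on X (\<lambda>y. Q (k y))" if "continuous_on X k" for k :: "'z::topological_space \<Rightarrow> _" and X
    using continuous_on_compose2[OF Q that] by simp
  have cu: "continuous_on X (\<lambda>w. u w t)" if "0 < t" for t X
    using continuous_on_subset[OF cont[OF that]] by blast
  define \<psi> where "\<psi> w = \<phi> (Q 0 *v w - z)" for w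
  have c\<psi>: "continuous_on X \<psi>" for X unfolding \<psi>_def[abs_def] by (intro comp continuous_intros)
  have supp\<psi>: "\<psi> w = 0" if "w \<notin> S" for w unfolding \<psi>_def by (rule supp[OF that]) (use K in auto)
  have "{w. \<psi> w \<noteq> 0} \<subseteq> S" using supp\<psi> by blast
  then have "compact (closure {w. \<psi> w \<noteq> 0})"
    unfolding compact_closure S_def by (rule bounded_subset[OF bounded_cbox])
  then have lim: "((\<lambda>t. LINT w|lebesgue. u w t * \<psi> w) \<longlongrightarrow> (LINT w|lebesgue. f w * \<psi> w)) (at_right 0)"
    using iv c\<psi> unfolding has_initial_value_def by blast
  have leb: "(LINT w|lebesgue. F w) = integral S F" "integrable lebesgue F"
    if "continuous_on UNIV F" "\<And>w. w \<notin> S \<Longrightarrow> F w = 0" for F :: "real ^ 'n \<Rightarrow> real"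
  proof -
    have "F \<in> borel_measurable lborel" using borel_measurable_continuous_onI[OF that(1)] by simp
    then show "(LINT w|lebesgue. F w) = integral S F" "integrable lebesgue F"
      using integral_lborel_supported[OF that(1), of p q] that(2) integral_completion[of F lborel]
        integrable_completion[of F lborel] by (auto simp: S_def)
  qed
  \<comment> \<open>If \<open>f * \<psi>\<close> were not integrable, the left-hand side would be \<open>0\<close> by convention; the comparison
    covers this case because the right-hand integrand is nonnegative.\<close>
  have "(LINT w|lebesgue. f w * \<psi> w) \<le> (LINT w|lebesgue. C * \<psi> w)"
  proof (rule integral_mono')
    show "integrable lebesgue (\<lambda>w. C * \<psi> w)" by (rule leb(2)) (auto intro!: continuous_intros c\<psi> simp: supp\<psi>)
  qed (use f \<phi>(2) in \<open>auto simp: \<psi>_def intro!: mult_right_mono\<close>)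
  also have "\<dots> = integral S (\<lambda>w. C * \<psi> w)"
    by (rule leb(1)) (auto intro!: continuous_intros c\<psi> simp: supp\<psi>)
  finally have "(LINT w|lebesgue. f w * \<psi> w) < integral S (\<lambda>w. C * \<psi> w) + e / 2" using \<open>0 < e\<close> by simp
  with lim have "\<forall>\<^sub>F t in at_right 0. (LINT w|lebesgue. u w t * \<psi> w) < integral S (\<lambda>w. C * \<psi> w) + e / 2"
    by (rule order_tendstoD(2))
  moreover have "filterlim snd (at_right 0) (at (z, 0 :: real) within UNIV \<times> {0<..})"
  proof -
    have "(snd \<longlongrightarrow> 0) (at (z, 0 :: real) within UNIV \<times> {0<..})" by (intro tendsto_eq_intros) auto
    then show ?thesis
      by (auto simp: filterlim_at eventually_at_filter intro!: always_eventually)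
  qed
  ultimately have ev1: "\<forall>\<^sub>F xt in at (z, 0) within UNIV \<times> {0<..}.
      (LINT w|lebesgue. u w (snd xt) * \<psi> w) < integral S (\<lambda>w. C * \<psi> w) + e / 2"
    by (rule eventually_compose_filterlim)
  define err where "err xt = integral S (\<lambda>w. \<bar>\<phi> (Q (snd xt) *v w - fst xt) - \<psi> w\<bar>)" for xt
  have L: "0 \<le> L" using ub[of 1 undefined] by simp
  have "continuous_on UNIV err" unfolding err_def S_def
  proof (rule integral_continuous_on_param)
    have "continuous_on (UNIV \<times> cbox p q) (\<lambda>y. \<psi> (snd y))"
      by (rule continuous_on_compose2[OF c\<psi>[of UNIV] continuous_on_snd[OF continuous_on_id]]) simp
    then show "continuous_on (UNIV \<times> cbox p q) (\<lambda>(xt, w). \<bar>\<phi> (Q (snd xt) *v w - fst xt) - \<psi> w\<bar>)"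
      unfolding split_beta by (intro continuous_intros comp cQ)
  qed
  then have "isCont err (z, 0)" by (simp add: continuous_on_eq_continuous_at)
  then have "(err \<longlongrightarrow> err (z, 0)) (at (z, 0) within UNIV \<times> {0<..})"
    unfolding isCont_def using tendsto_within_subset by blast
  moreover have "err (z, 0) < e / (2 * (L + 1))" using L \<open>0 < e\<close> by (simp add: err_def \<psi>_def)
  ultimately have ev2: "\<forall>\<^sub>F xt in at (z, 0) within UNIV \<times> {0<..}. err xt < e / (2 * (L + 1))"
    by (rule order_tendstoD(2))
  have ev3: "\<forall>\<^sub>F xt in at (z, 0) within UNIV \<times> {0<..}. dist (fst xt) z < 1 \<and> 0 < snd xt \<and> snd xt < T"
  proof -
    have l: "((\<lambda>xt. dist (fst xt) z) \<longlongrightarrow> 0) (at (z, 0 :: real) within UNIV \<times> {0<..})"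
      "(snd \<longlongrightarrow> 0) (at (z, 0 :: real) within UNIV \<times> {0<..})" by (intro tendsto_eq_intros refl | simp)+
    have "\<forall>\<^sub>F xt in at (z, 0 :: real) within UNIV \<times> {0<..}. dist (fst xt) z < 1"
      "\<forall>\<^sub>F xt in at (z, 0 :: real) within UNIV \<times> {0<..}. snd xt < T"
      using order_tendstoD(2)[OF l(1), of 1] order_tendstoD(2)[OF l(2) K(3)] by simp_all
    moreover have "\<forall>\<^sub>F xt in at (z, 0 :: real) within UNIV \<times> {0<..}. 0 < snd xt"
      by (auto simp: eventually_at_filter intro!: always_eventually)
    ultimately show ?thesis by eventually_elim simp
  qed
  have "\<forall>\<^sub>F xt in at (z, 0) within UNIV \<times> {0<..}.
    (\<forall>w. w \<notin> S \<longrightarrow> \<phi> (Q (snd xt) *v w - fst xt) = 0) \<and>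
    - e \<le> integral S (\<lambda>w. \<phi> (Q (snd xt) *v w - fst xt) * (C - u w (snd xt)))"
    using ev1 ev2 ev3
  proof eventually_elim
    case (elim xt)
    obtain x t where xt: "xt = (x, t)" by (cases xt)
    have t: "0 < t" "t < T" and x: "dist x z < 1" using elim(3) by (auto simp: xt)
    have int: "F integrable_on S" if "continuous_on S F" for F :: "real ^ 'n \<Rightarrow> real"
      using that unfolding S_def by (rule integrable_continuous)
    define h where "h w = \<phi> (Q t *v w - x)" for w
    have ch: "continuous_on X h" for X unfolding h_def[abs_def] by (intro comp continuous_intros)
    have i1: "(\<lambda>w. \<psi> w * (C - u w t)) integrable_on S" "(\<lambda>w. \<bar>h w - \<psi> w\<bar>) integrable_on S"
      "(\<lambda>w. C * \<psi> w) integrable_on S" "(\<lambda>w. u w t * \<psi> w) integrable_on S" "(\<lambda>w. h w * (C - u w t)) integrable_on S"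
      "(\<lambda>w. L * \<bar>h w - \<psi> w\<bar>) integrable_on S"
      by (intro int continuous_intros ch c\<psi> cu t)+
    have "integral S (\<lambda>w. u w t * \<psi> w) < integral S (\<lambda>w. C * \<psi> w) + e / 2"
      using elim(1) leb(1)[of "\<lambda>w. u w t * \<psi> w"] cu[OF t(1)] c\<psi> by (simp add: xt supp\<psi> continuous_on_mult)
    moreover have "integral S (\<lambda>w. \<psi> w * (C - u w t)) = integral S (\<lambda>w. C * \<psi> w) - integral S (\<lambda>w. u w t * \<psi> w)"
      by (subst integral_diff[OF i1(3,4), symmetric]) (simp add: algebra_simps)
    ultimately have a: "- (e / 2) \<le> integral S (\<lambda>w. \<psi> w * (C - u w t))" by simp
    have "L * err xt \<le> L * (e / (2 * (L + 1)))" using elim(2) L by (intro mult_left_mono) auto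
    also have "\<dots> \<le> e / 2" using L \<open>0 < e\<close> by (simp add: field_simps)
    finally have b: "L * integral S (\<lambda>w. \<bar>h w - \<psi> w\<bar>) \<le> e / 2" by (simp add: err_def xt h_def)
    have "integral S (\<lambda>w. \<psi> w * (C - u w t)) - L * integral S (\<lambda>w. \<bar>h w - \<psi> w\<bar>)
        = integral S (\<lambda>w. \<psi> w * (C - u w t) - L * \<bar>h w - \<psi> w\<bar>)"
      by (subst integral_diff) (auto intro: i1 simp: integral_mult_right)
    also have "\<dots> \<le> integral S (\<lambda>w. h w * (C - u w t))"
    proof (rule integral_le)
      fix w
      have "- ((h w - \<psi> w) * (C - u w t)) \<le> \<bar>h w - \<psi> w\<bar> * \<bar>C - u w t\<bar>"
        by (metis abs_ge_minus_self abs_mult)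
      also have "\<dots> \<le> \<bar>h w - \<psi> w\<bar> * L" by (intro mult_left_mono ub t) simp
      finally show "\<psi> w * (C - u w t) - L * \<bar>h w - \<psi> w\<bar> \<le> h w * (C - u w t)" by (simp add: algebra_simps)
    qed (auto intro!: i1 integrable_diff)
    finally have "- e \<le> integral S (\<lambda>w. h w * (C - u w t))" using a b by simp
    moreover have "\<phi> (Q t *v w - x) = 0" if "w \<notin> S" for w by (rule supp[OF that]) (use x t in auto)
    ultimately show ?case by (simp add: xt h_def)
  qed
  then show ?thesis using that[of p q] by (simp add: S_def)
qed

lemma matrix_vector_norm_bound:
  fixes P :: "real \<Rightarrow> real ^ 'n ^ 'm"
  assumes "continuous_on UNIV P"
  obtains K where "0 < K" "\<And>t y. 0 \<le> t \<Longrightarrow> t \<le> T \<Longrightarrow> norm (P t *v y) \<le> K * norm y"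
proof -
  obtain k where k: "0 < k" "\<And>(M :: real ^ 'n ^ 'm) y. norm (M *v y) \<le> norm M * norm y * k"
    using bounded_bilinear.pos_bounded[OF bounded_bilinear_matrix_vector_mult] by blast
  have "compact (P ` {0..T})"
    by (rule compact_continuous_image[OF continuous_on_subset[OF assms]]) auto
  then obtain b where b: "\<And>t. t \<in> {0..T} \<Longrightarrow> norm (P t) \<le> b" 
    using compact_imp_bounded[of "P ` {0..T}"] unfolding bounded_iff by blast
  show ?thesis
  proof (rule that[of "(\<bar>b\<bar> + 1) * k"])
    fix t :: real and y :: "real ^ 'n" assume "0 \<le> t" "t \<le> T"
    then have "norm (P t) \<le> \<bar>b\<bar> + 1" using b[of t] by auto
    then have "norm (P t) * norm y * k \<le> (\<bar>b\<bar> + 1) * norm y * k"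
      using k(1) by (intro mult_right_mono) auto
    then show "norm (P t *v y) \<le> (\<bar>b\<bar> + 1) * k * norm y"
      using k(2)[of "P t" y] by (simp add: mult_ac)
  qed (use k(1) in \<open>simp add: add_nonneg_pos\<close>)
qed

lemma smooth_heat_solution_const_diff:
  assumes "smooth_heat_solution a t0 w G H"
  shows "smooth_heat_solution a t0 (\<lambda>x t. C - w x t) (\<lambda>x t. - G x t) (\<lambda>x t. - H x t)"
  unfolding smooth_heat_solution_def
proof (intro conjI allI impI)
  fix x t assume t: "t0 < t"
  show "((\<lambda>y. C - w y t) has_derivative (\<lambda>h. - G x t \<bullet> h)) (at x)"
    using has_derivative_diff[OF has_derivative_const smooth_heat_solutionD(1)[OF assms t], of C] by simp
  have "(*v) (- H x t) = (\<lambda>h. - (H x t *v h))"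
    by (simp add: fun_eq_iff bounded_bilinear.minus_left[OF bounded_bilinear_matrix_vector_mult])
  then show "((\<lambda>y. - G y t) has_derivative (*v) (- H x t)) (at x)"
    using has_derivative_minus[OF smooth_heat_solutionD(2)[OF assms t]] by simp
  have "trace (a t ** - H x t) = - trace (a t ** H x t)"
    by (simp add: bounded_bilinear.minus_right[OF bounded_bilinear_matrix_mult]
        linear_neg[OF bounded_linear.linear[OF bounded_linear_trace]])
  then show "((\<lambda>t. C - w x t) has_real_derivative 1 / 2 * trace (a t ** - H x t)) (at t)"
    using DERIV_diff[OF DERIV_const smooth_heat_solutionD(3)[OF assms t], of C] by simp
qed (use smooth_heat_solution_continuous[OF assms] in \<open>auto simp: split_beta intro!: continuous_intros\<close>)

text \<open>
  If \<open>u\<close> exceeded \<open>C\<close> at some point, then the average of \<open>C - u\<close> over translates by small vectors would be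
  negative there.  This average solves the heat equation and has a nonnegative lower limit at
  time \<open>0\<close>, so the minimum principle excludes it.
\<close>

lemma solution_le_initial_bound:
  fixes u :: "real ^ 'n \<Rightarrow> real \<Rightarrow> real" and P Q :: "real \<Rightarrow> real ^ 'n ^ 'n"
  assumes sol: "smooth_heat_solution a 0 (\<lambda>z t. u (P t *v z) t) G H"
    and a: "continuous_on {0<..} a"
    and sym: "\<And>t. 0 < t \<Longrightarrow> transpose (a t) = a t"
    and psd: "\<And>t v. 0 < t \<Longrightarrow> 0 \<le> (a t *v v) \<bullet> v"
    and tr: "\<And>t. 0 < t \<Longrightarrow> t \<le> T \<Longrightarrow> trace (a t) \<le> k"
    and iv: "has_initial_value u f" and f: "\<And>y. f y \<le> C" "0 \<le> C"
    and ub: "\<And>x t. 0 < t \<Longrightarrow> \<bar>C - u x t\<bar> \<le> L"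
    and cont: "\<And>t. 0 < t \<Longrightarrow> continuous_on UNIV (\<lambda>w. u w t)"
    and P: "continuous_on UNIV P" and Q: "continuous_on UNIV Q"
    and inv: "\<And>t. P t ** Q t = Finite_Cartesian_Product.mat 1" "\<And>t. Q t ** P t = Finite_Cartesian_Product.mat 1"
    and T: "0 < T"
  shows "u (P T *v x) T \<le> C"
proof (rule ccontr)
  assume neg: "\<not> u (P T *v x) T \<le> C"
  have PQ: "P t *v (Q t *v y) = y" "Q t *v (P t *v y) = y" for y t
    using inv by (simp_all add: matrix_vector_mul_assoc)
  define U where "U z t = u (P t *v z) t" for z t
  have cU: "continuous_on X (\<lambda>y. U (g y) t)" if "0 < t" "continuous_on X g" for t X and g :: "real ^ 'n \<Rightarrow> real ^ 'n"
    unfolding U_def by (rule continuous_on_compose2[OF cont[OF that(1)]]) (auto intro!: continuous_intros that)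
  have "isCont (\<lambda>y. U (x + y) T) 0"
    using cU[OF T, of UNIV "\<lambda>y. x + y"] by (simp add: continuous_on_eq_continuous_at continuous_intros)
  then have "((\<lambda>y. U (x + y) T) \<longlongrightarrow> U (x + 0) T) (nhds 0)"
    using tendsto_at_iff_tendsto_nhds[of "\<lambda>y. U (x + y) T" 0] by (simp add: isCont_def)
  from order_tendstoD(1)[OF this, of C] neg have "\<forall>\<^sub>F y in nhds 0. C < U (x + y) T"
    by (simp add: U_def)
  then obtain d where d: "0 < d" "\<And>y. norm y < d \<Longrightarrow> C < U (x + y) T"
    unfolding eventually_nhds_metric by (auto simp: dist_norm)
  define \<phi> :: "real ^ 'n \<Rightarrow> real" where "\<phi> y = max 0 (d - norm y)" for y
  have c\<phi>: "continuous_on X \<phi>" for X unfolding \<phi>_def by (intro continuous_intros)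
  have \<phi>: "0 \<le> \<phi> y" "d \<le> norm y \<Longrightarrow> \<phi> y = 0" for y by (auto simp: \<phi>_def)
  define p q :: "real ^ 'n" where "p = - d *\<^sub>R One" and "q = d *\<^sub>R One"
  have supp: "\<phi> y = 0" if "y \<notin> cbox p q" for y
    using that cball_subset_One_cbox[of d] by (intro \<phi>(2)) (force simp: p_def q_def)
  define v where "v z t = integral (cbox p q) (\<lambda>y. \<phi> y * (C - U (z + y) t))" for z t
  have int: "(\<lambda>y. \<phi> y * (C - U (z + y) t)) integrable_on cbox p q" if "0 < t" for z t
    by (intro integrable_continuous continuous_intros c\<phi> cU that)
  have sol': "heat_solution a 0 v" unfolding v_def[abs_def]
    by (rule heat_solution_average[OF smooth_heat_solution_const_diff[OF sol] a c\<phi>, folded U_def])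
  obtain K1 where K1: "0 < K1" "\<And>t y. 0 \<le> t \<Longrightarrow> t \<le> T \<Longrightarrow> norm (P t *v y) \<le> K1 * norm y"
    using matrix_vector_norm_bound[OF P, where T = T] by blast
  obtain K2 where K2: "0 < K2" "\<And>t y. 0 \<le> t \<Longrightarrow> t \<le> T \<Longrightarrow> norm (Q t *v y) \<le> K2 * norm y"
    using matrix_vector_norm_bound[OF Q, where T = T] by blast
  define D where "D = measure lborel (ball (0 :: real ^ 'n) K2) / measure lborel (ball (0 :: real ^ 'n) 1)"
  have D: "0 \<le> D" by (simp add: D_def)
  have "0 \<le> v x T"
  proof (rule heat_minimum_principle[OF sol' sym psd tr])
    show "- (integral (cbox p q) (\<lambda>y. \<phi> y * L)) \<le> v z t" if "0 < t" for z t
    proof -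
      have "integral (cbox p q) (\<lambda>y. - (\<phi> y * L)) \<le> v z t" unfolding v_def
      proof (rule integral_le)
        show "(\<lambda>y. - (\<phi> y * L)) integrable_on cbox p q"
          by (intro integrable_continuous continuous_intros c\<phi>)
        fix y
        have "- L \<le> C - U (z + y) t" using ub[OF that, of "P t *v (z + y)"] by (simp add: U_def abs_le_iff)
        then have "\<phi> y * - L \<le> \<phi> y * (C - U (z + y) t)" by (intro mult_left_mono \<phi>)
        then show "- (\<phi> y * L) \<le> \<phi> y * (C - U (z + y) t)" by simp
      qed (rule int[OF that])
      then show ?thesis by simp
    qed
    fix z :: "real ^ 'n" and e :: real assume e: "0 < e"
    have "norm y \<le> K1 * norm (Q t *v y)" if "0 \<le> t" "t \<le> T" for t y
      using K1(2)[OF that, of "Q t *v y"] by (simp add: PQ)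
    from smoothed_initial_value_bound[OF iv f ub cont Q this K1(1) T c\<phi> \<phi>, where e = "e / (D + 1)" and z = z] e D
    obtain p' q' where ev: "\<forall>\<^sub>F xt in at (z, 0) within UNIV \<times> {0<..}.
      (\<forall>w. w \<notin> cbox p' q' \<longrightarrow> \<phi> (Q (snd xt) *v w - fst xt) = 0) \<and>
      - (e / (D + 1)) \<le> integral (cbox p' q') (\<lambda>w. \<phi> (Q (snd xt) *v w - fst xt) * (C - u w (snd xt)))"
      by (auto simp: add_nonneg_pos)
    have "(snd \<longlongrightarrow> 0) (at (z, 0 :: real) within UNIV \<times> {0<..})" by (intro tendsto_eq_intros refl | simp)+
    from order_tendstoD(2)[OF this T] have "\<forall>\<^sub>F xt in at (z, 0 :: real) within UNIV \<times> {0<..}. snd xt < T" .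
    moreover have "\<forall>\<^sub>F xt in at (z, 0 :: real) within UNIV \<times> {0<..}. 0 < snd xt"
      by (auto simp: eventually_at_filter intro!: always_eventually)
    ultimately show "\<forall>\<^sub>F xt in at (z, 0) within UNIV \<times> {0<..}. - e \<le> v (fst xt) (snd xt)"
      using ev
    proof eventually_elim
      case (elim xt)
      define y t where "y = fst xt" and "t = snd xt"
      have t: "0 \<le> t" "t \<le> T" "0 < t" using elim by (auto simp: t_def)
      define I where "I = integral (cbox p' q') (\<lambda>w. \<phi> (Q t *v w - y) * (C - u w t))"
      have I: "- (e / (D + 1)) \<le> I" and s: "\<And>w. w \<notin> cbox p' q' \<Longrightarrow> \<phi> (Q t *v w - y) = 0"
        using elim by (auto simp: I_def y_def t_def)
      have "continuous_on UNIV (\<lambda>w. C - u w t)" by (intro continuous_intros cont t)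
      then obtain c where c: "0 \<le> c" "c \<le> D" "v y t = c * I"
        using average_change_of_variables[OF inv[of t] K2(2)[OF t(1,2)] K2(1) _ c\<phi>, of "\<lambda>w. C - u w t" p q p' q' y]
          supp s unfolding D_def[symmetric] v_def U_def I_def by blast
      have "c * (e / (D + 1)) \<le> D * (e / (D + 1))" using c D e by (intro mult_right_mono) auto
      also have "\<dots> \<le> e" using D e by (simp add: field_simps)
      finally have "- e \<le> c * - (e / (D + 1))" by simp
      also have "\<dots> \<le> v y t" unfolding c(3) using I c(1) by (rule mult_left_mono)
      finally show ?case by (simp add: y_def t_def)
    qed
  qed (use T in auto)
  moreover define F where "F y = - (\<phi> y * (C - U (x + y) T))" for y
  have F: "0 \<le> F y" for y
    using d(2)[of y] \<phi>[of y] by (cases "norm y < d") (auto simp: F_def mult_le_0_iff mult_nonneg_nonpos)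
  have cF: "continuous_on (cbox p q) F" unfolding F_def by (intro continuous_intros c\<phi> cU T)
  have "integral (cbox p q) F = - v x T" unfolding F_def[abs_def] v_def by (rule integral_neg)
  moreover have "0 \<le> integral (cbox p q) F"
    using F by (intro integral_nonneg integrable_continuous cF) auto
  ultimately have "integral (cbox p q) F = 0" by simp
  moreover have z: "0 \<in> box p q" using d(1) by (simp add: p_def q_def mem_box inner_sum_left_Basis)
  ultimately have "F 0 = 0"
    using integral_cbox_eq_0_iff[OF cF] F box_subset_cbox by blast
  then show False using d(1) d(2)[of 0] by (simp add: F_def \<phi>_def)
qed

section \<open>Coordinates that follow the drift\<close>

lemma has_derivative_grad:
  fixes g :: "real ^ 'n \<Rightarrow> real"
  assumes "g differentiable (at x)"
  shows "(g has_derivative (\<lambda>h. grad g x \<bullet> h)) (at x)"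
proof -
  note d = assms[unfolded frechet_derivative_works]
  have lin: "linear (frechet_derivative g (at x))" using d has_derivative_linear by blast
  have "frechet_derivative g (at x) h = grad g x \<bullet> h" for h
  proof -
    have h: "h = (\<Sum>i\<in>UNIV. h $ i *\<^sub>R axis i 1)" by (simp add: basis_expansion flip: scalar_mult_eq_scaleR)
    have "frechet_derivative g (at x) h = (\<Sum>i\<in>UNIV. h $ i * frechet_derivative g (at x) (axis i 1))"
      by (subst h) (simp add: linear_sum[OF lin] linear_cmul[OF lin])
    then show ?thesis by (simp add: grad_def inner_vec_def mult.commute)
  qed
  then have "frechet_derivative g (at x) = (\<lambda>h. grad g x \<bullet> h)" by (rule ext)
  with d show ?thesis by simp
qed

lemma grad_eqI:
  fixes g :: "real ^ 'n \<Rightarrow> real"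
  assumes "(g has_derivative (\<lambda>h. v \<bullet> h)) (at x)"
  shows "grad g x = v"
  by (simp add: grad_def inner_axis Finite_Cartesian_Product.vec_eq_iff frechet_derivative_at[OF assms, symmetric])

lemma inner_transpose: "(transpose M *v v) \<bullet> h = v \<bullet> (M *v h)" for M :: "real ^ 'n ^ 'm"
  by (simp add: transpose_matrix_vector dot_lmul_matrix)

lemma flow_E_shift_has_derivative:
  "((\<lambda>t. flow_E B (t - T)) has_vector_derivative - (transpose B ** flow_E B (t - T))) (at t)"
proof -
  have "((\<lambda>t. t - T) has_vector_derivative 1) (at t)" by (auto intro!: derivative_eq_intros)
  from vector_diff_chain_at[OF this flow_E_has_derivative] show ?thesis by (simp add: o_def)
qed

text \<open>
  The diffusion matrix in the coordinates \<open>z = flow_E B (T - t) *v x\<close>, which follow the drift and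
  agree with the original ones at time \<open>T\<close>.
\<close>

definition transported_A :: "real ^ 'n ^ 'n \<Rightarrow> real ^ 'n ^ 'n \<Rightarrow> real \<Rightarrow> real \<Rightarrow> real ^ 'n ^ 'n" where
  "transported_A A B T t = flow_E B (T - t) ** A ** transpose (flow_E B (T - t))"

lemma kolmogorov_op_eq_trace:
  assumes "grad g differentiable (at x)"
  shows "kolmogorov_op A B g x = 1 / 2 * trace (A ** jacobian (grad g) (at x)) + x \<bullet> (B *v grad g x)"
proof -
  have d: "(grad g has_derivative (*v) (jacobian (grad g) (at x))) (at x)"
    using assms jacobian_works by blast
  have "((\<lambda>y. A *v grad g y) has_derivative (\<lambda>h. A *v (jacobian (grad g) (at x) *v h))) (at x)"
    by (rule bounded_linear.has_derivative[OF matrix_vector_mul_bounded_linear d])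
  from frechet_derivative_at[OF this, symmetric]
  have "divergence (\<lambda>y. A *v grad g y) x = hess_trace A ((*v) (jacobian (grad g) (at x)))"
    by (simp add: divergence_def hess_trace_def)
  then show ?thesis by (simp add: kolmogorov_op_def hess_trace_matrix)
qed

text \<open>
  The drift term of \<open>kolmogorov_op\<close> cancels against the derivative of the moving point \<open>P t *v z\<close>, and the
  second-order term is transformed by conjugation with the inverse flow.
\<close>

lemma smooth_heat_solution_transport:
  fixes u :: "real ^ 'n \<Rightarrow> real \<Rightarrow> real" and A B :: "real ^ 'n ^ 'n" and T :: real
  assumes u: "C21 u" and eq: "\<And>x t. 0 < t \<Longrightarrow> kolmogorov_op A B (\<lambda>y. u y t) x = deriv (u x) t"
  defines "P \<equiv> \<lambda>t. flow_E B (t - T)"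
  shows "smooth_heat_solution (transported_A A B T) 0 (\<lambda>z t. u (P t *v z) t)
    (\<lambda>z t. transpose (P t) *v grad (\<lambda>y. u y t) (P t *v z))
    (\<lambda>z t. transpose (P t) ** jacobian (grad (\<lambda>y. u y t)) (at (P t *v z)) ** P t)"
proof -
  define g where "g x t = grad (\<lambda>y. u y t) x" for x t
  have gg: "grad (\<lambda>y. u y t) = (\<lambda>x. g x t)" for t by (simp add: g_def fun_eq_iff)
  define J where "J x t = jacobian (\<lambda>y. g y t) (at x)" for x t
  have du: "((\<lambda>y. u y t) has_derivative (\<lambda>h. g x t \<bullet> h)) (at x)" if "0 < t" for x t
    unfolding g_def using u that by (intro has_derivative_grad) (simp add: C21_def)
  have dg: "((\<lambda>y. g y t) has_derivative (*v) (J x t)) (at x)" if "0 < t" for x t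
    unfolding J_def using u that jacobian_works by (auto simp: C21_def gg)
  have dt: "(u x has_real_derivative 1 / 2 * trace (A ** J x t) + x \<bullet> (B *v g x t)) (at t)" if "0 < t" for x t
  proof -
    have "(u x has_real_derivative deriv (u x) t) (at t)"
      using u that by (simp add: C21_def DERIV_deriv_iff_real_differentiable)
    moreover have "deriv (u x) t = 1 / 2 * trace (A ** J x t) + x \<bullet> (B *v g x t)"
      using eq[OF that, of x] kolmogorov_op_eq_trace[of "\<lambda>y. u y t" x A B] u that by (simp add: C21_def gg J_def)
    ultimately show ?thesis by simp
  qed
  have cu: "continuous_on (UNIV \<times> {0<..}) (\<lambda>(x, t). u x t)"
    and cg: "continuous_on (UNIV \<times> {0<..}) (\<lambda>(x, t). g x t)"
    and cJ: "continuous_on (UNIV \<times> {0<..}) (\<lambda>(x, t). J x t)"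
    using u by (simp_all add: C21_def gg J_def)
  have cP: "continuous_on X (\<lambda>p. P (snd p))" for X :: "((real ^ 'n) \<times> real) set"
    unfolding P_def by (intro continuous_intros)
  have comp: "continuous_on (UNIV \<times> {0<..}) (\<lambda>p. F (P (snd p) *v fst p) (snd p))"
    if "continuous_on (UNIV \<times> {0<..}) (\<lambda>(x, t). F x t)" for F :: "real ^ 'n \<Rightarrow> real \<Rightarrow> 'c::topological_space"
    using continuous_on_compose2[OF that, of "UNIV \<times> {0<..}" "\<lambda>p. (P (snd p) *v fst p, snd p)"]
    by (force intro!: continuous_intros cP)
  show ?thesis unfolding smooth_heat_solution_def gg J_def[symmetric]
  proof (intro conjI allI impI)
    fix z :: "real ^ 'n" and t :: real assume t: "0 < t"
    define x where "x = P t *v z"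
    define S where "S = flow_E B (T - t)"
    have PS: "P t ** S = Finite_Cartesian_Product.mat 1"
      using flow_E_inverse[of B "t - T"] by (simp add: P_def S_def)
    have lin: "((\<lambda>z. P t *v z) has_derivative (*v) (P t)) (at z)" for z
      by (rule bounded_linear_imp_has_derivative) simp
    show "((\<lambda>y. u (P t *v y) t) has_derivative (\<lambda>h. (transpose (P t) *v g (P t *v z) t) \<bullet> h)) (at z)"
      using has_derivative_compose[OF lin du[OF t]]
      by (rule has_derivative_eq_rhs) (simp add: fun_eq_iff inner_transpose del: transpose_matrix_vector)
    have "((\<lambda>y. g (P t *v y) t) has_derivative (\<lambda>h. J (P t *v z) t *v (P t *v h))) (at z)"
      using has_derivative_compose[OF lin dg[OF t]] by simp
    from bounded_linear.has_derivative[OF matrix_vector_mul_bounded_linear this]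
    have "((\<lambda>y. transpose (P t) *v g (P t *v y) t) has_derivative
        (\<lambda>h. transpose (P t) *v (J (P t *v z) t *v (P t *v h)))) (at z)" .
    then show "((\<lambda>y. transpose (P t) *v g (P t *v y) t) has_derivative
        (*v) (transpose (P t) ** J (P t *v z) t ** P t)) (at z)"
      by (rule has_derivative_eq_rhs) (simp add: fun_eq_iff matrix_vector_mul_assoc matrix_mul_assoc)
    have "((\<lambda>t. P t *v z) has_vector_derivative - (transpose B ** P t) *v z) (at t)"
      unfolding P_def by (rule bounded_linear.has_vector_derivative[OF
            bounded_bilinear.bounded_linear_left[OF bounded_bilinear_matrix_vector_mult] flow_E_shift_has_derivative])
    from has_real_derivative_along_curve[of 0 u g, OF du cg dt[OF t] this t]
    have "((\<lambda>t. u (P t *v z) t) has_real_derivative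
        1 / 2 * trace (A ** J x t) + x \<bullet> (B *v g x t) + g x t \<bullet> (- (transpose B ** P t) *v z)) (at t)"
      by (simp add: x_def)
    also have "g x t \<bullet> (- (transpose B ** P t) *v z) = - (x \<bullet> (B *v g x t))"
      using inner_transpose[of B x "g x t"]
      by (simp add: x_def bounded_bilinear.minus_left[OF bounded_bilinear_matrix_vector_mult]
          inner_commute[of "g _ _"] flip: matrix_vector_mul_assoc del: transpose_matrix_vector)
    also have "trace (A ** J x t) = trace (transported_A A B T t ** (transpose (P t) ** J x t ** P t))"
    proof -
      have "transpose S ** transpose (P t) = Finite_Cartesian_Product.mat 1"
        using PS by (metis matrix_transpose_mul transpose_mat)
      then have "transported_A A B T t ** (transpose (P t) ** J x t ** P t) = S ** (A ** J x t ** P t)"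
        by (simp add: transported_A_def S_def[symmetric] matrix_mul_assoc[symmetric])
          (simp add: matrix_mul_assoc)
      also have "trace \<dots> = trace ((A ** J x t ** P t) ** S)" by (rule trace_mul_sym)
      also have "(A ** J x t ** P t) ** S = A ** J x t" by (simp add: matrix_mul_assoc[symmetric] PS)
      finally show ?thesis by simp
    qed
    finally show "((\<lambda>t. u (P t *v z) t) has_real_derivative
       1 / 2 * trace (transported_A A B T t ** (transpose (P t) ** J (P t *v z) t ** P t))) (at t)"
      by (simp add: x_def)
  qed (auto simp: split_beta intro!: continuous_intros cP comp[OF cu] comp[OF cg] comp[OF cJ]
      simp del: transpose_matrix_vector)
qed

section \<open>The estimate for the Kolmogorov operator\<close>

lemma block_A_symmetric:
  assumes c: "block_coordinates r m c" and "A0 \<in> carrier_mat (m 0) (m 0)" "transpose_mat A0 = A0"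
  shows "transpose (block_A c A0) = block_A c A0"
proof -
  have "A0 $$ (i, j) = A0 $$ (j, i)" if "i < m 0" "j < m 0" for i j
    using assms(2,3) that by (metis carrier_matD index_transpose_mat(1))
  moreover have "snd (c p) < m 0" if "fst (c p) = 0" for p
    using c that unfolding block_coordinates_def bij_betw_def by (metis UNIV_I imageI lessThan_iff mem_Sigma_iff prod.collapse)
  ultimately show ?thesis
    by (simp add: block_A_def transpose_def Finite_Cartesian_Product.vec_eq_iff)
qed

text \<open>
  The quadratic form of \<open>block_A c A0\<close> at \<open>v\<close> is that of \<open>A0\<close> at the components of \<open>v\<close> in the first block.
\<close>

lemma block_A_psd:
  fixes c :: "'n::finite \<Rightarrow> nat \<times> nat"
  assumes c: "block_coordinates r m c" and A0: "A0 \<in> carrier_mat (m 0) (m 0)" and pd: "pos_def_mat (m 0) A0"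
  shows "0 \<le> (block_A c A0 *v v) \<bullet> v"
proof -
  define Z where "Z = {p. fst (c p) = 0}"
  have bij: "bij_betw (\<lambda>p. snd (c p)) Z {..<m 0}"
    unfolding bij_betw_def
  proof
    have inj: "inj c" and ran: "range c = (SIGMA k:{..r}. {..<m k})"
      using c by (auto simp: block_coordinates_def bij_betw_def)
    show "inj_on (\<lambda>p. snd (c p)) Z" using inj by (auto simp: Z_def inj_on_def prod_eq_iff)
    show "(\<lambda>p. snd (c p)) ` Z = {..<m 0}"
    proof (intro equalityI subsetI)
      fix i assume "i \<in> (\<lambda>p. snd (c p)) ` Z"
      then obtain p where "fst (c p) = 0" "i = snd (c p)" by (auto simp: Z_def)
      moreover have "c p \<in> (SIGMA k:{..r}. {..<m k})" using ran by blast
      ultimately show "i \<in> {..<m 0}" by (auto simp: mem_Times_iff Sigma_def)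
    next
      fix i assume "i \<in> {..<m 0}"
      then have "(0, i) \<in> range c" using ran by simp
      then obtain p where "c p = (0, i)" by (metis rangeE)
      then show "i \<in> (\<lambda>p. snd (c p)) ` Z" by (intro image_eqI[where x = p]) (simp_all add: Z_def)
    qed
  qed
  define w where "w = Matrix.vec (m 0) (\<lambda>i. v $ inv_into Z (\<lambda>p. snd (c p)) i)"
  have w: "w \<in> carrier_vec (m 0)" by (simp add: w_def)
  have wi: "Matrix.vec_index w (snd (c p)) = v $ p" if "p \<in> Z" for p
    using bij_betwE[OF bij] that by (simp add: w_def inv_into_f_f[OF bij_betw_imp_inj_on[OF bij] that])
  have "Matrix.scalar_prod w (A0 *\<^sub>v w) =
      (\<Sum>i<m 0. Matrix.vec_index w i * (\<Sum>j<m 0. A0 $$ (i, j) * Matrix.vec_index w j))"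
    using A0 w by (simp add: Matrix.scalar_prod_def lessThan_atLeast0)
  also have "\<dots> = (\<Sum>p\<in>Z. v $ p * (\<Sum>q\<in>Z. A0 $$ (snd (c p), snd (c q)) * v $ q))"
    by (simp add: sum.reindex_bij_betw[OF bij, symmetric] wi cong: sum.cong)
  also have "\<dots> = (\<Sum>p\<in>UNIV. v $ p * (\<Sum>q\<in>UNIV. block_A c A0 $ p $ q * v $ q))"
  proof (intro sum.mono_neutral_cong_left ballI)
    show "v $ p * (\<Sum>q\<in>UNIV. block_A c A0 $ p $ q * v $ q) = 0" if "p \<in> UNIV - Z" for p
      using that by (simp add: block_A_def Z_def)
    show "v $ p * (\<Sum>q\<in>Z. A0 $$ (snd (c p), snd (c q)) * v $ q) = v $ p * (\<Sum>q\<in>UNIV. block_A c A0 $ p $ q * v $ q)"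
      if "p \<in> Z" for p
      by (intro arg_cong2[of _ _ _ _ "(*)"] refl sum.mono_neutral_cong_left) (use that in \<open>auto simp: block_A_def Z_def\<close>)
  qed auto
  also have "\<dots> = (block_A c A0 *v v) \<bullet> v"
    by (simp add: inner_vec_def matrix_vector_mult_def mult.commute)
  finally have eq: "Matrix.scalar_prod w (A0 *\<^sub>v w) = (block_A c A0 *v v) \<bullet> v" .
  show ?thesis
  proof (cases "w = 0\<^sub>v (m 0)")
    case True
    then have "Matrix.scalar_prod w (A0 *\<^sub>v w) = 0" using A0 by (simp add: Matrix.scalar_prod_def)
    then show ?thesis using eq by simp
  next
    case False
    then show ?thesis using pd w eq unfolding pos_def_mat_def by fastforce
  qed
qed

text \<open>
  The estimate for the drift-free equation, read in the coordinates that agree with the original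
  ones at the time \<open>t\<close> of the estimate; reversing time turns the integral of \<open>transported_A\<close> into the
  covariance.
\<close>

lemma kolmogorov_gradient_estimate:
  fixes u :: "real ^ 'n \<Rightarrow> real \<Rightarrow> real" and A B :: "real ^ 'n ^ 'n"
  assumes sym: "transpose A = A" and psd: "\<And>v. 0 \<le> (A *v v) \<bullet> v"
    and f: "\<forall>y. 0 \<le> f y \<and> f y \<le> C" and sol: "pos_bounded_solution A B f u" and t: "0 < t"
  shows "1 / 2 * ((covariance A B t *v grad (\<lambda>y. ln (u y t)) x) \<bullet> grad (\<lambda>y. ln (u y t)) x) \<le> ln (C / u x t)"
proof -
  have u: "C21 u" and eq: "\<And>x t. 0 < t \<Longrightarrow> kolmogorov_op A B (\<lambda>y. u y t) x = deriv (u x) t"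
    and pos: "\<And>x t. 0 < t \<Longrightarrow> 0 < u x t" and iv: "has_initial_value u f"
    using sol by (auto simp: pos_bounded_solution_def)
  obtain K where K: "\<And>x t. 0 < t \<Longrightarrow> u x t \<le> K" using sol by (auto simp: pos_bounded_solution_def)
  define a where "a = transported_A A B t"
  define P where "P s = flow_E B (s - t)" for s
  have sol': "smooth_heat_solution a 0 (\<lambda>z s. u (P s *v z) s)
    (\<lambda>z s. transpose (P s) *v grad (\<lambda>y. u y s) (P s *v z))
    (\<lambda>z s. transpose (P s) ** jacobian (grad (\<lambda>y. u y s)) (at (P s *v z)) ** P s)"
    unfolding a_def P_def by (rule smooth_heat_solution_transport[OF u eq])
  have ca: "continuous_on X a" for X
    unfolding a_def transported_A_def[abs_def] by (intro continuous_intros)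
  have cP: "continuous_on X P" for X unfolding P_def[abs_def] by (intro continuous_intros)
  have a_sym: "transpose (a s) = a s" for s
    by (simp add: a_def transported_A_def matrix_transpose_mul sym matrix_mul_assoc transpose_transpose)
  have a_psd: "0 \<le> (a s *v v) \<bullet> v" for s v
    using psd[of "transpose (flow_E B (t - s)) *v v"] inner_transpose[of "transpose (flow_E B (t - s))"]
    by (simp add: a_def transported_A_def flip: matrix_vector_mul_assoc)
  have tr: "\<exists>k. \<forall>s. 0 < s \<longrightarrow> s \<le> S \<longrightarrow> trace (a s) \<le> k" for S
  proof -
    have "compact ((\<lambda>s. trace (a s)) ` {0..S})"
      by (rule compact_continuous_image[OF bounded_linear.continuous_on[OF bounded_linear_trace ca]]) simp
    then obtain k where k: "\<forall>y\<in>(\<lambda>s. trace (a s)) ` {0..S}. norm y \<le> k"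
      using compact_imp_bounded[of "(\<lambda>s. trace (a s)) ` {0..S}"] unfolding bounded_iff by blast
    have "trace (a s) \<le> k" if "0 < s" "s \<le> S" for s using k that by (force simp: abs_le_iff)
    then show ?thesis by blast
  qed
  have C: "0 \<le> C" using f order_trans[of 0 "f x" C] by simp
  have uC: "u (P s *v z) s \<le> C" if s: "0 < s" for z s
  proof -
    obtain k where k: "\<And>s'. 0 < s' \<Longrightarrow> s' \<le> s \<Longrightarrow> trace (a s') \<le> k" using tr by blast
    show ?thesis
    proof (rule solution_le_initial_bound[OF sol' ca a_sym a_psd k iv _ C, where Q = "\<lambda>s. flow_E B (t - s)" and L = "\<bar>C\<bar> + \<bar>K\<bar>"])
      show "\<bar>C - u x s\<bar> \<le> \<bar>C\<bar> + \<bar>K\<bar>" if "0 < s" for x s using pos[OF that, of x] K[OF that, of x] by linarith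
      show "continuous_on UNIV (\<lambda>w. u w s)" if "0 < s" for s
        using u that unfolding C21_def
        by (intro continuous_at_imp_continuous_on ballI differentiable_imp_continuous_within) blast
      show "P s ** flow_E B (t - s) = Finite_Cartesian_Product.mat 1"
        "flow_E B (t - s) ** P s = Finite_Cartesian_Product.mat 1" for s
        using flow_E_inverse[of B "s - t"] flow_E_inverse[of B "t - s"] by (simp_all add: P_def)
      show "continuous_on UNIV (\<lambda>s. flow_E B (t - s))" by (intro continuous_intros)
    qed (use f cP s in auto)
  qed
  define \<Gamma> where "\<Gamma> s = integral {0..s} a" for s
  have \<Gamma>': "(\<Gamma> has_vector_derivative a s) (at s)" if "0 < s" for s
    using integral_has_vector_derivative[OF ca, of s 0 "s + 1"] that
    by (simp add: \<Gamma>_def[abs_def] at_within_Icc_at)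
  have "continuous_on {0..1} \<Gamma>" unfolding \<Gamma>_def[abs_def]
    by (intro indefinite_integral_continuous_1 integrable_continuous_real ca)
  then have "(\<Gamma> \<longlongrightarrow> \<Gamma> 0) (at 0 within {0..1})" by (simp add: continuous_on_def)
  then have \<Gamma>0: "(\<Gamma> \<longlongrightarrow> 0) (at_right 0)" by (simp add: at_within_Icc_at_right \<Gamma>_def)
  have \<Gamma>t: "\<Gamma> t = covariance A B t"
  proof -
    define h where "h s = flow_E B s ** A ** transpose (flow_E B s)" for s
    have ch: "continuous_on X h" for X unfolding h_def[abs_def] by (intro continuous_intros)
    have "\<Gamma> t = integral {- 0..- (- t)} (\<lambda>s. (\<lambda>s. h (s + t)) (- s))"
      by (simp add: \<Gamma>_def a_def transported_A_def[abs_def] h_def)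
    also have "\<dots> = integral {- t..0} (\<lambda>s. h (s + t))"
      using integral_reflect[where a = "- t" and b = 0 and f = "\<lambda>s. h (s + t)"] by (simp only: cbox_interval)
    also have "\<dots> = integral {- t + t..0 + t} h"
      using integral_shift[OF ch, of "- t" 0 t] by (simp add: o_def)
    finally show ?thesis by (simp add: covariance_def h_def[abs_def])
  qed
  have Pt: "P t = Finite_Cartesian_Product.mat 1" by (simp add: P_def)
  define \<theta> where "\<theta> = (1 / u x t) *\<^sub>R grad (\<lambda>y. u y t) x"
  have "((\<lambda>y. u y t) has_derivative (\<lambda>h. grad (\<lambda>y. u y t) x \<bullet> h)) (at x)"
    using u t by (intro has_derivative_grad) (simp add: C21_def)
  from DERIV_ln_divide[OF pos[OF t, of x]]
  have "((\<lambda>y. ln (u y t)) has_derivative (\<lambda>h. \<theta> \<bullet> h)) (at x)"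
    using has_derivative_compose[OF \<open>((\<lambda>y. u y t) has_derivative _) _\<close>, of ln "(*) (1 / u x t)"]
    by (simp add: has_field_derivative_def \<theta>_def)
  then have "grad (\<lambda>y. ln (u y t)) x = \<theta>" by (rule grad_eqI)
  moreover obtain k where k: "\<And>s. 0 < s \<Longrightarrow> s \<le> t \<Longrightarrow> trace (a s) \<le> k" using tr by blast
  have "1 / 2 * ((\<Gamma> t *v \<theta>) \<bullet> \<theta>) \<le> ln (C / u (P t *v x) t)"
    by (rule heat_gradient_estimate[OF sol' a_sym a_psd k \<Gamma>' \<Gamma>0 _ t])
      (auto simp: pos uC Pt \<theta>_def transpose_mat)
  ultimately show ?thesis by (simp add: \<Gamma>t Pt)
qed

theorem proposition3p4:
  fixes r :: nat and m :: "nat \<Rightarrow> nat"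
    and A0 :: "real mat" and Bs :: "nat \<Rightarrow> real mat"
    and c :: "'n::finite \<Rightarrow> nat \<times> nat"
    and A B :: "real ^ 'n ^ 'n"
    and f :: "real ^ 'n \<Rightarrow> real" and u :: "real ^ 'n \<Rightarrow> real \<Rightarrow> real" and C :: real
    and x :: "real ^ 'n" and t :: real
  assumes "r \<ge> 1"
    and "\<forall>k<r. m (Suc k) \<le> m k" and "m r \<ge> 1"
    and "A0 \<in> carrier_mat (m 0) (m 0)" and "transpose_mat A0 = A0" and "pos_def_mat (m 0) A0"
    and "\<forall>k\<in>{1..r}. Bs k \<in> carrier_mat (m (k - 1)) (m k)"
    and "\<forall>k\<in>{1..r}. vec_space.rank (m (k - 1)) (Bs k) = m k"
    and "block_coordinates r m c"
    and "A = block_A c A0" and "B = block_B c Bs"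
    and "f \<in> borel_measurable lebesgue" and "\<forall>y. 0 \<le> f y \<and> f y \<le> C"
    and "pos_bounded_solution A B f u"
    and "t > 0"
  shows "1 / 2 * ((covariance A B t *v grad (\<lambda>y. ln (u y t)) x) \<bullet> grad (\<lambda>y. ln (u y t)) x)
           \<le> ln (C / u x t)"
proof (rule kolmogorov_gradient_estimate[OF _ _ \<open>\<forall>y. 0 \<le> f y \<and> f y \<le> C\<close> \<open>pos_bounded_solution A B f u\<close> \<open>t > 0\<close>])
  show "transpose A = A"
    unfolding \<open>A = block_A c A0\<close>
    by (rule block_A_symmetric[OF \<open>block_coordinates r m c\<close> \<open>A0 \<in> carrier_mat (m 0) (m 0)\<close> \<open>transpose_mat A0 = A0\<close>])
  show "0 \<le> (A *v v) \<bullet> v" for v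
    unfolding \<open>A = block_A c A0\<close>
    by (rule block_A_psd[OF \<open>block_coordinates r m c\<close> \<open>A0 \<in> carrier_mat (m 0) (m 0)\<close> \<open>pos_def_mat (m 0) A0\<close>])
qed

end
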